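(* There exist infinitely many real quadratic fields, as well as infinitely many imaginary quadratic fields, whose ideal class group has an element of order $3$ in its non-genus part (i.e. in the principal genus, the subgroup of squares of the class group). *)

theory Defs
  imports
    Complex_Main
    "HOL-Computational_Algebra.Polynomial"
    "HOL-Computational_Algebra.Group_Closure"
    "HOL-Algebra.Algebraic_Closure_Type"
    "HOL-Algebra.Ideal"
    "HOL-Algebra.Coset"
    "HOL-Algebra.Multiplicative_Group"
begin

text \<open>
  Quadratic fields are taken as subfields of the complex numbers. A quadratic field is normal over
  the rationals, so all its embeddings have the same image: distinct subfields are non-isomorphic,
  and counting subfields is counting fields up to isomorphism.
\<close>

definition quadratic_field :: "complex set \<Rightarrow> bool" where
  "quadratic_field K \<longleftrightarrow>
     subfield K ring_of_type_algebra \<and> ring.dimension ring_of_type_algebra 2 \<rat> K"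

definition real_quadratic_field :: "complex set \<Rightarrow> bool" where
  "real_quadratic_field K \<longleftrightarrow> quadratic_field K \<and> K \<subseteq> \<real>"

definition imaginary_quadratic_field :: "complex set \<Rightarrow> bool" where
  "imaginary_quadratic_field K \<longleftrightarrow> quadratic_field K \<and> \<not> K \<subseteq> \<real>"

definition ring_of_integers :: "complex set \<Rightarrow> complex ring" where
  "ring_of_integers K = ring_of_type_algebra\<lparr>carrier := {z \<in> K. algebraic_int z}\<rparr>"

definition fractional_ideals :: "complex set \<Rightarrow> complex set set" where
  "fractional_ideals K =
     {(\<lambda>x. x / d) ` J | d J. d \<in> carrier (ring_of_integers K) \<and> d \<noteq> 0 \<and>
        ideal J (ring_of_integers K) \<and> J \<noteq> {0}}"

definition principal_fractional_ideals :: "complex set \<Rightarrow> complex set set" where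
  "principal_fractional_ideals K =
     {(\<lambda>x. a * x) ` carrier (ring_of_integers K) | a. a \<in> K \<and> a \<noteq> 0}"

text \<open>The product consists of the finite sums of products \<open>x * y\<close> with \<open>x \<in> I\<close> and \<open>y \<in> J\<close>.\<close>

definition fractional_ideal_group :: "complex set \<Rightarrow> complex set monoid" where
  "fractional_ideal_group K =
     \<lparr>carrier = fractional_ideals K,
      monoid.mult = (\<lambda>I J. group_closure {x * y | x y. x \<in> I \<and> y \<in> J}),
      one = carrier (ring_of_integers K)\<rparr>"

text \<open>
  This is the class group in the ordinary (wide) sense: for real fields no positivity condition is
  imposed on generators of principal ideals.
\<close>

definition ideal_class_group :: "complex set \<Rightarrow> complex set set monoid" where
  "ideal_class_group K = fractional_ideal_group K Mod principal_fractional_ideals K"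

definition principal_genus :: "complex set \<Rightarrow> complex set set set" where
  "principal_genus K =
     {c \<otimes>\<^bsub>ideal_class_group K\<^esub> c | c. c \<in> carrier (ideal_class_group K)}"

end

theory Submission
  imports Defs "HOL-Computational_Algebra.Nth_Powers"
begin

text \<open>
  A class \<open>c\<close> of order 3 satisfies \<open>c = c\<^sup>4 = (c\<^sup>2)\<^sup>2\<close>, so it lies in the principal genus automatically; it
  suffices to find infinitely many real and infinitely many imaginary quadratic fields whose class
  group contains an element of order 3.

  The source of such elements is the following criterion (\<open>class_of_order_3\<close>). Let \<open>\<alpha>\<close> be an integer
  of \<open>K\<close> with norm \<open>m\<^sup>3\<close> and with trace coprime to \<open>m\<close>. Then \<open>\<alpha>\<close> and its conjugate are comaximal, so
  the ideal \<open>I = (\<alpha>, m)\<close> satisfies \<open>I\<^sup>3 = (\<alpha>)\<close>. If \<open>I\<close> were principal, \<open>\<alpha>\<close> would be a unit times a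
  cube; when this is excluded, the class of \<open>I\<close> has order 3.

  In the imaginary case \<open>\<alpha> = (1 + \<surd>(1 - 4m\<^sup>3)) / 2\<close> has trace 1 and norm \<open>m\<^sup>3\<close>. For \<open>3 dvd m\<close> every unit of
  the field is a cube, and \<open>\<alpha>\<close> itself is no cube, because the trace \<open>t\<close> of a cube root would be an
  integer with \<open>t (t\<^sup>2 - 3m) = 1\<close>.

  In the real case \<open>m\<close> is odd, \<open>\<epsilon> = (m\<^sup>3 + \<surd>(m\<^sup>6 + 4)) / 2\<close> is a unit of norm -1 and \<open>\<alpha> = \<epsilon> + 1\<close> has norm \<open>m\<^sup>3\<close> and trace
  \<open>m\<^sup>3 + 2\<close>. The units are cyclic up to sign and \<open>\<epsilon>\<close> is not a cube, so modulo cubes every unit is a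
  power of \<open>\<epsilon>\<close>, and one has to exclude that \<open>\<alpha>\<close>, \<open>\<alpha>\<epsilon>\<close> or \<open>\<alpha>/\<epsilon>\<close> is a cube. If \<open>3 dvd m\<close>, all three have
  trace 2 modulo 9 and norm divisible by 3, which is impossible for a cube since the trace of a cube
  is \<open>t\<^sup>3 - 3nt\<close> with \<open>t\<close> and \<open>n\<close> the trace and norm of the root.

  No control of square factors of the radicands \<open>d(m)\<close> is needed to see that infinitely many fields
  arise: if \<open>\<surd>d\<close> and \<open>\<surd>e\<close> generate the same field then \<open>d e\<close> is a square, so that \<open>\<bar>d\<bar>\<close> is a square if
  \<open>d\<close> and \<open>e\<close> are coprime. Given finitely many values \<open>d(a)\<close>, taking for \<open>m\<close> a multiple of all of them
  makes \<open>d(m)\<close> coprime to each: it is 1, respectively 4, modulo each of them, and in the second case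
  they are odd.

  That the fractional ideals form a group is proved directly: if \<open>J\<close> is a nonzero ideal and \<open>g\<close> is
  the greatest common divisor of the norms of its elements, then the product of \<open>J\<close> with its conjugate
  is the principal ideal \<open>(g)\<close> (\<open>ideal_times_conjugate\<close>).
\<close>

section \<open>Quadratic fields and their integers\<close>

lemma rational_root_of_monic_quadratic:
  fixes r t n :: complex
  assumes "r \<in> \<rat>" "t \<in> \<int>" "n \<in> \<int>" "r * r - t * r + n = 0"
  shows "r \<in> \<int>"
proof -
  have "algebraic_int r"
  proof (rule algebraic_int.intros)
    show "lead_coeff [:n, - t, 1:] = 1" by simp
    show "\<forall>i. Polynomial.coeff [:n, - t, 1:] i \<in> \<int>"
      using assms by (auto simp: coeff_pCons split: nat.splits)
    show "poly [:n, - t, 1:] r = 0" using assms(4) by (simp add: algebra_simps)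
  qed
  then show ?thesis using assms(1) rational_algebraic_int_is_int by blast
qed

lemma rational_root_of_int:
  fixes r :: complex
  assumes "r \<in> \<rat>" "r * r = of_int n"
  obtains k :: int where "r = of_int k" "k * k = n"
proof -
  have "r \<in> \<int>" using rational_root_of_monic_quadratic[of r 0 "- of_int n"] assms by simp
  then obtain k :: int where k: "r = of_int k" by (auto elim: Ints_cases)
  moreover have "(of_int (k * k) :: complex) = of_int n" using assms(2) k by simp
  then have "k * k = n" by (simp only: of_int_eq_iff)
  ultimately show ?thesis using that by blast
qed

text \<open>
  The numbers \<open>x + y s\<close> with rational \<open>x\<close> and \<open>y\<close>, which form the field generated by \<open>s\<close> when \<open>s\<close> is
  a square root of a rational number. Rational numbers are represented by the set of rational complex numbers, so that no
  coercions occur.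
\<close>
definition adjoin :: "complex \<Rightarrow> complex set" where
  "adjoin s = {x + y * s | x y. x \<in> \<rat> \<and> y \<in> \<rat>}"

text \<open>A quadratic field with a chosen square root \<open>s\<close> of an integer \<open>d\<close>, not assumed squarefree.\<close>
locale quadratic =
  fixes d :: int and s :: complex
  assumes s_sq: "s * s = of_int d" and s_irrational: "s \<notin> \<rat>"
begin

abbreviation K :: "complex set" where "K \<equiv> adjoin s"

text \<open>
  The nontrivial automorphism of \<open>K\<close>, sending \<open>s\<close> to \<open>-s\<close>. It differs from complex conjugation when
  \<open>s\<close> is real, and it is meaningful on \<open>K\<close> only. Trace and norm of \<open>z\<close> are written out as
  \<open>z + qconj z\<close> and \<open>z * qconj z\<close>.
\<close>
definition qconj :: "complex \<Rightarrow> complex" where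
  "qconj z = (THE w. \<exists>x\<in>\<rat>. \<exists>y\<in>\<rat>. z = x + y * s \<and> w = x - y * s)"

lemma coordinates_unique:
  assumes "x \<in> \<rat>" "y \<in> \<rat>" "x' \<in> \<rat>" "y' \<in> \<rat>" "x + y * s = x' + y' * s"
  shows "x = x'" "y = y'"
proof -
  have eq: "(y - y') * s = x' - x" using assms(5) by (simp add: algebra_simps)
  show "y = y'"
  proof (rule ccontr)
    assume "y \<noteq> y'"
    then have "s = (x' - x) / (y - y')" using eq by (simp add: field_simps)
    then have "s \<in> \<rat>" using assms by simp
    then show False using s_irrational by simp
  qed
  then show "x = x'" using assms(5) by simp
qed

lemma K_cases:
  assumes "z \<in> K"
  obtains x y where "x \<in> \<rat>" "y \<in> \<rat>" "z = x + y * s"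
  using assms by (auto simp: adjoin_def)

lemma K_I: "x \<in> \<rat> \<Longrightarrow> y \<in> \<rat> \<Longrightarrow> x + y * s \<in> K"
  by (auto simp: adjoin_def)

lemma qconj_eq:
  assumes "x \<in> \<rat>" "y \<in> \<rat>"
  shows "qconj (x + y * s) = x - y * s"
  unfolding qconj_def
proof (rule the_equality)
  show "\<exists>x'\<in>\<rat>. \<exists>y'\<in>\<rat>. x + y * s = x' + y' * s \<and> x - y * s = x' - y' * s"
    using assms by blast
next
  fix w assume "\<exists>x'\<in>\<rat>. \<exists>y'\<in>\<rat>. x + y * s = x' + y' * s \<and> w = x' - y' * s"
  then obtain x' y' where "x' \<in> \<rat>" "y' \<in> \<rat>" "x + y * s = x' + y' * s" "w = x' - y' * s" by blast
  then show "w = x - y * s" using coordinates_unique[OF assms, of x' y'] by simp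
qed

lemma Rats_subset_K: "x \<in> \<rat> \<Longrightarrow> x \<in> K"
  using K_I[of x 0] by simp

lemma qconj_rat [simp]: "x \<in> \<rat> \<Longrightarrow> qconj x = x"
  using qconj_eq[of x 0] by simp

lemma K_diff: "z \<in> K \<Longrightarrow> w \<in> K \<Longrightarrow> z - w \<in> K"
  and qconj_diff: "z \<in> K \<Longrightarrow> w \<in> K \<Longrightarrow> qconj (z - w) = qconj z - qconj w"
proof -
  assume z: "z \<in> K" and w: "w \<in> K"
  from z obtain x y where 1: "x \<in> \<rat>" "y \<in> \<rat>" "z = x + y * s" by (rule K_cases)
  from w obtain x' y' where 2: "x' \<in> \<rat>" "y' \<in> \<rat>" "w = x' + y' * s" by (rule K_cases)
  have eq: "z - w = (x - x') + (y - y') * s" using 1 2 by (simp add: algebra_simps)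
  then show "z - w \<in> K" using 1 2 by (simp only: eq) (intro K_I, simp_all)
  have "qconj (z - w) = (x - x') - (y - y') * s" unfolding eq using 1 2 by (intro qconj_eq) simp_all
  also have "\<dots> = qconj z - qconj w"
    unfolding 1(3) 2(3) qconj_eq[OF 1(1,2)] qconj_eq[OF 2(1,2)] by (simp add: algebra_simps)
  finally show "qconj (z - w) = qconj z - qconj w" .
qed

lemma K_mult: "z \<in> K \<Longrightarrow> w \<in> K \<Longrightarrow> z * w \<in> K"
  and qconj_mult: "z \<in> K \<Longrightarrow> w \<in> K \<Longrightarrow> qconj (z * w) = qconj z * qconj w"
proof -
  assume z: "z \<in> K" and w: "w \<in> K"
  from z obtain x y where 1: "x \<in> \<rat>" "y \<in> \<rat>" "z = x + y * s" by (rule K_cases)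
  from w obtain x' y' where 2: "x' \<in> \<rat>" "y' \<in> \<rat>" "w = x' + y' * s" by (rule K_cases)
  have eq: "(x + y * t) * (x' + y' * t) = (x * x' + y * y' * of_int d) + (x * y' + y * x') * t"
    if "t * t = of_int d" for t
  proof -
    have "(x + y * t) * (x' + y' * t) = (x * x' + y * y' * (t * t)) + (x * y' + y * x') * t"
      by (simp add: algebra_simps)
    then show ?thesis using that by simp
  qed
  have eq1: "z * w = (x * x' + y * y' * of_int d) + (x * y' + y * x') * s"
    using eq[OF s_sq] 1 2 by simp
  then show "z * w \<in> K" using 1 2 by (simp only: eq1) (intro K_I, simp_all)
  have "qconj (z * w) = (x * x' + y * y' * of_int d) - (x * y' + y * x') * s"
    unfolding eq1 using 1 2 by (intro qconj_eq) simp_all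
  also have "\<dots> = qconj z * qconj w"
    using eq[of "- s"] s_sq qconj_eq[OF 1(1,2)] qconj_eq[OF 2(1,2)] unfolding 1(3) 2(3) by simp
  finally show "qconj (z * w) = qconj z * qconj w" .
qed

lemma K_0 [simp]: "0 \<in> K" and K_1 [simp]: "1 \<in> K" and K_of_int [simp]: "of_int n \<in> K"
  by (auto intro: Rats_subset_K)

lemma s_in_K [simp]: "s \<in> K"
  using K_I[of 0 1] by simp

lemma K_minus: "z \<in> K \<Longrightarrow> - z \<in> K" using K_diff[of 0 z] by simp

lemma K_add: "z \<in> K \<Longrightarrow> w \<in> K \<Longrightarrow> z + w \<in> K"
  using K_diff[of z "- w"] K_minus by simp

lemma qconj_minus: "z \<in> K \<Longrightarrow> qconj (- z) = - qconj z"
  using qconj_diff[of 0 z] by simp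

lemma qconj_add: "z \<in> K \<Longrightarrow> w \<in> K \<Longrightarrow> qconj (z + w) = qconj z + qconj w"
  using qconj_diff[of z "- w"] K_minus qconj_minus by simp

lemma qconj_in_K: "z \<in> K \<Longrightarrow> qconj z \<in> K"
  and qconj_conj: "z \<in> K \<Longrightarrow> qconj (qconj z) = z"
  and trace_Rats: "z \<in> K \<Longrightarrow> z + qconj z \<in> \<rat>"
  and norm_Rats: "z \<in> K \<Longrightarrow> z * qconj z \<in> \<rat>"
proof -
  assume z: "z \<in> K"
  then obtain x y where 1: "x \<in> \<rat>" "y \<in> \<rat>" "z = x + y * s" by (rule K_cases)
  have c: "qconj z = x + (- y) * s" unfolding 1(3) using qconj_eq[OF 1(1,2)] by simp
  show "qconj z \<in> K" unfolding c using 1 by (intro K_I) simp_all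
  show "qconj (qconj z) = z" unfolding c using 1 by (subst qconj_eq) simp_all
  show "z + qconj z \<in> \<rat>" unfolding c using 1 by simp
  have "z * qconj z = x * x - y * y * (s * s)" unfolding c unfolding 1(3) by (simp add: algebra_simps)
  then show "z * qconj z \<in> \<rat>" using 1 s_sq by simp
qed

lemma qconj_power: assumes "z \<in> K" shows "qconj (z ^ n) = qconj z ^ n"
proof -
  have "z ^ n \<in> K \<and> qconj (z ^ n) = qconj z ^ n"
    using assms by (induction n) (auto simp: K_mult qconj_mult)
  then show ?thesis by blast
qed

lemma qconj_eq_0_iff: "z \<in> K \<Longrightarrow> qconj z = 0 \<longleftrightarrow> z = 0"
  by (metis Rats_0 qconj_conj qconj_rat)

lemma norm_eq_0_iff: "z \<in> K \<Longrightarrow> z * qconj z = 0 \<longleftrightarrow> z = 0"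
  using qconj_eq_0_iff by simp

lemma K_inverse: "z \<in> K \<Longrightarrow> inverse z \<in> K"
proof (cases "z = 0")
  case False
  assume z: "z \<in> K"
  have "inverse z = inverse (z * qconj z) * qconj z"
    using False qconj_eq_0_iff[OF z] by simp
  then show ?thesis
    using K_mult[OF Rats_subset_K qconj_in_K[OF z]] norm_Rats[OF z] by (metis Rats_inverse)
qed simp

lemma K_divide: "z \<in> K \<Longrightarrow> w \<in> K \<Longrightarrow> z / w \<in> K"
  by (simp add: divide_inverse K_mult K_inverse)

text \<open>The ring of integers of \<open>K\<close>, as a set.\<close>
definition OK :: "complex set" where "OK = {z \<in> K. algebraic_int z}"

lemma Ints_imp_algebraic:
  assumes "z + qconj z \<in> \<int>" "z * qconj z \<in> \<int>"
  shows "algebraic_int z"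
proof (rule algebraic_int.intros)
  let ?p = "[:z * qconj z, - (z + qconj z), 1:]"
  show "lead_coeff ?p = 1" by simp
  show "\<forall>i. Polynomial.coeff ?p i \<in> \<int>"
    using assms Ints_minus[OF assms(1)] by (auto simp: coeff_pCons split: nat.splits)
  show "poly ?p z = 0" by (simp add: algebra_simps)
qed

lemma linear_root_imp_zero:
  assumes z: "z \<in> K" "z \<notin> \<rat>" and r: "Polynomial.degree r < 2"
    and root: "poly (map_poly of_int r) z = 0"
  shows "r = 0"
proof -
  obtain a b where r_eq: "r = [:a, b:]"
    using r by (metis degree_eq_zeroE degree_pCons_eq_if less_2_cases pCons_cases Suc_inject pCons_0_0 One_nat_def)
  have e: "of_int a + z * of_int b = 0" using root unfolding r_eq by (simp add: map_poly_pCons)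
  have "b = 0"
  proof (rule ccontr)
    assume "b \<noteq> 0"
    have "z * of_int b = - of_int a" using e by (simp add: add_eq_0_iff)
    then have "z = - of_int a / of_int b" using \<open>b \<noteq> 0\<close> by (simp add: field_simps)
    moreover have "- of_int a / of_int b \<in> (\<rat> :: complex set)" by simp
    ultimately show False using z by simp
  qed
  then show ?thesis using e r_eq by simp
qed

text \<open>
  For irrational \<open>z\<close> this is Gauss's lemma: the primitive integer multiple \<open>g\<close> of the minimal
  polynomial divides a monic integer polynomial, hence has leading coefficient 1 or -1.
\<close>
lemma algebraic_imp_Ints:
  assumes z: "z \<in> K" and alg: "algebraic_int z"
  shows "z + qconj z \<in> \<int> \<and> z * qconj z \<in> \<int>"
proof (cases "z \<in> \<rat>")
  case True
  then have "z \<in> \<int>" using alg rational_algebraic_int_is_int by blast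
  then show ?thesis using True by simp
next
  case False
  obtain t n where tn: "z + qconj z = of_rat t" "z * qconj z = of_rat n"
    using trace_Rats[OF z] norm_Rats[OF z] by (auto elim!: Rats_cases)
  obtain t1 a1 where t: "a1 > 0" "t = of_int t1 / of_int a1"
    by (metis Fract_of_int_quotient Rat_cases_nonzero Rat_cases)
  obtain n1 b1 where n: "b1 > 0" "n = of_int n1 / of_int b1"
    by (metis Fract_of_int_quotient Rat_cases_nonzero Rat_cases)
  define f where "f = [:n1 * a1, - (t1 * b1), a1 * b1:]"
  have f0: "f \<noteq> 0" and df: "Polynomial.degree f = 2" using t n by (auto simp: f_def)
  have rel: "z * z - of_rat t * z + of_rat n = 0" unfolding tn[symmetric] by (simp add: algebra_simps)
  have "(of_int t1 :: complex) = of_rat t * of_int a1" "(of_int n1 :: complex) = of_rat n * of_int b1"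
    using t n by (simp_all add: of_rat_divide)
  then have "poly (map_poly of_int f) z = of_int (a1 * b1) * (z * z - of_rat t * z + of_rat n)"
    by (simp add: f_def map_poly_pCons algebra_simps)
  then have froot: "poly (map_poly of_int f) z = 0" using rel by simp
  define g where "g = primitive_part f"
  have g0: "g \<noteq> 0" and dg: "Polynomial.degree g = 2" using f0 df by (auto simp: g_def)
  have cg: "content g = 1" using f0 by (simp add: g_def)
  have "f = smult (content f) g" by (simp add: g_def)
  then have "map_poly of_int f = (smult (of_int (content f)) (map_poly of_int g) :: complex poly)"
    by (metis map_poly_smult of_int_0 of_int_mult)
  then have "poly (map_poly of_int f) z = of_int (content f) * poly (map_poly of_int g) z"
    by simp
  then have groot: "poly (map_poly of_int g) z = 0" using froot f0 by simp
  obtain p where p: "poly (map_poly of_int p) z = 0" "lead_coeff p = 1"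
    using alg by (auto simp: algebraic_int_altdef_ipoly)
  obtain a q where aq: "a \<noteq> 0" "smult a p = g * q + pseudo_mod p g"
    using pseudo_mod(1)[OF g0] by blast
  \<comment> \<open>The pseudo-remainder of \<open>p\<close> by \<open>g\<close> is linear and vanishes at \<open>z\<close>, so it is zero.\<close>
  have dr: "Polynomial.degree (pseudo_mod p g) < 2"
    using pseudo_mod(2)[OF g0, of p] dg by auto
  have hom: "map_poly of_int (u * v) = (map_poly of_int u * map_poly of_int v :: complex poly)"
     "map_poly of_int (u + v) = (map_poly of_int u + map_poly of_int v :: complex poly)"
    "map_poly of_int (smult c u) = (smult (of_int c) (map_poly of_int u) :: complex poly)" for u v c
    by (auto intro!: poly_eqI simp: coeff_map_poly coeff_mult)
  have "poly (map_poly of_int (smult a p)) z = 0" using p by (simp add: hom)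
  then have "poly (map_poly of_int (pseudo_mod p g)) z = 0"
    unfolding aq(2) using groot by (simp add: hom)
  then have "pseudo_mod p g = 0" using linear_root_imp_zero[OF z False dr] by blast
  then have apq: "smult a p = g * q" using aq(2) by simp
  have "content p dvd 1" using p(2) by (metis content_dvd_coeff)
  then have "content p = 1" by (simp only: is_unit_content_iff)
  then have "content (smult a p) = normalize a" by simp
  then have cq: "content q = normalize a" unfolding apq using cg by (simp add: content_mult)
  have "a dvd content q" unfolding cq by simp
  then have "[:a:] dvd q" by (simp add: const_poly_dvd_iff_dvd_content)
  then obtain q' where "q = [:a:] * q'" by (rule dvdE)
  then have "smult a p = smult a (g * q')" using apq by simp
  then have pg: "p = g * q'" using aq(1) by (metis smult_cancel)
  then have "lead_coeff g * lead_coeff q' = 1" using p(2) by (metis lead_coeff_mult)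
  then have u: "lead_coeff g = 1 \<or> lead_coeff g = -1" by (metis dvdI zdvd1_eq abs_eq_iff' abs_1 mult.commute)
  obtain l where fl: "f = smult l g" using \<open>f = smult (content f) g\<close> by blast
  define c where "c = lead_coeff g"
  have cc: "c * c = 1" using u by (auto simp: c_def)
  have g2: "Polynomial.coeff g 2 = c" using dg by (simp add: c_def)
  have l: "l * c = a1 * b1" "l * Polynomial.coeff g 1 = - (t1 * b1)" "l * Polynomial.coeff g 0 = n1 * a1"
    using arg_cong[OF fl, of "\<lambda>p. Polynomial.coeff p 2"] arg_cong[OF fl, of "\<lambda>p. Polynomial.coeff p 1"]
      arg_cong[OF fl, of "\<lambda>p. Polynomial.coeff p 0"] g2
    by (simp_all add: f_def numeral_2_eq_2)
  have l': "l = c * (a1 * b1)" using l(1) cc by (metis mult.assoc mult.commute mult_1)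
  have "b1 * t1 = b1 * (a1 * (- c * Polynomial.coeff g 1))" using l(2) unfolding l' by (simp add: algebra_simps)
  then have "t1 = a1 * (- c * Polynomial.coeff g 1)" using n(1) by (metis mult_cancel_left less_irrefl)
  then have tt: "t = of_int (- c * Polynomial.coeff g 1)" using t by simp
  have "a1 * n1 = a1 * (b1 * (c * Polynomial.coeff g 0))" using l(3)[symmetric] unfolding l' by (simp add: algebra_simps)
  then have "n1 = b1 * (c * Polynomial.coeff g 0)" using t(1) by (metis mult_cancel_left less_irrefl)
  then have "n = of_int (c * Polynomial.coeff g 0)" using n by simp
  with tt show ?thesis unfolding tn by (metis Ints_of_int of_rat_of_int_eq)
qed

lemma OK_iff: "z \<in> OK \<longleftrightarrow> z \<in> K \<and> z + qconj z \<in> \<int> \<and> z * qconj z \<in> \<int>"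
  using algebraic_imp_Ints Ints_imp_algebraic by (auto simp: OK_def)

lemma OK_subset_K: "z \<in> OK \<Longrightarrow> z \<in> K" by (simp add: OK_def)

text \<open>
  The two traces below are rational, and their sum and product are integers because they are
  polynomials in the traces and norms of \<open>z\<close> and \<open>w\<close>. Hence both are integers. This gives closure of
  the integers under products and differences without reference to an integral basis.
\<close>
lemma polar_traces_Ints:
  assumes z: "z \<in> OK" and w: "w \<in> OK"
  shows "z * w + qconj z * qconj w \<in> \<int>" "z * qconj w + qconj z * w \<in> \<int>"
proof -
  note zK = OK_subset_K[OF z] and wK = OK_subset_K[OF w]
  define P where "P = z * w + qconj z * qconj w"
  define Q where "Q = z * qconj w + qconj z * w"
  have P: "P \<in> \<rat>" using trace_Rats[OF K_mult[OF zK wK]] qconj_mult[OF zK wK] by (simp add: P_def)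
  have Q: "Q \<in> \<rat>" using trace_Rats[OF K_mult[OF zK qconj_in_K[OF wK]]]
      qconj_mult[OF zK qconj_in_K[OF wK]] qconj_conj[OF wK] by (simp add: Q_def)
  define Tz Nz Tw Nw where "Tz = z + qconj z" and "Nz = z * qconj z" and "Tw = w + qconj w" and "Nw = w * qconj w"
  have ints: "Tz \<in> \<int>" "Nz \<in> \<int>" "Tw \<in> \<int>" "Nw \<in> \<int>"
    using z w by (auto simp: OK_iff Tz_def Nz_def Tw_def Nw_def)
  have sum: "P + Q = Tz * Tw" by (simp add: P_def Q_def Tz_def Tw_def algebra_simps)
  have prod: "P * Q = Nw * (Tz * Tz - 2 * Nz) + Nz * (Tw * Tw - 2 * Nw)"
    by (simp add: P_def Q_def Tz_def Tw_def Nz_def Nw_def algebra_simps)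
  have s: "P + Q \<in> \<int>" and p: "P * Q \<in> \<int>" unfolding sum prod using ints by (auto intro!: Ints_mult Ints_add Ints_diff)
  have "P * P - (P + Q) * P + P * Q = 0" "Q * Q - (P + Q) * Q + P * Q = 0" by (simp_all add: algebra_simps)
  then have "P \<in> \<int>" "Q \<in> \<int>" using rational_root_of_monic_quadratic P Q s p by blast+
  then show "z * w + qconj z * qconj w \<in> \<int>" "z * qconj w + qconj z * w \<in> \<int>" by (simp_all add: P_def Q_def)
qed

lemma OK_mult: assumes z: "z \<in> OK" and w: "w \<in> OK" shows "z * w \<in> OK"
proof -
  note zK = OK_subset_K[OF z] and wK = OK_subset_K[OF w]
  have tr: "z * w + qconj (z * w) = z * w + qconj z * qconj w" using zK wK by (simp add: qconj_mult)
  have nm: "(z * w) * qconj (z * w) = (z * qconj z) * (w * qconj w)"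
    using zK wK by (simp add: qconj_mult algebra_simps)
  have "(z * qconj z) * (w * qconj w) \<in> \<int>"
    using z w by (auto simp: OK_iff intro!: Ints_mult)
  then show ?thesis using K_mult[OF zK wK] polar_traces_Ints(1)[OF z w] unfolding OK_iff tr nm by simp
qed

lemma OK_diff: assumes z: "z \<in> OK" and w: "w \<in> OK" shows "z - w \<in> OK"
proof -
  note zK = OK_subset_K[OF z] and wK = OK_subset_K[OF w]
  have tr: "(z - w) + qconj (z - w) = (z + qconj z) - (w + qconj w)" using zK wK by (simp add: qconj_diff)
  have nm: "(z - w) * qconj (z - w) = z * qconj z + w * qconj w - (z * qconj w + qconj z * w)"
    using zK wK by (simp add: qconj_diff algebra_simps)
  have "(z + qconj z) - (w + qconj w) \<in> \<int>" "z * qconj z + w * qconj w - (z * qconj w + qconj z * w) \<in> \<int>"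
    using z w polar_traces_Ints(2)[OF z w] by (auto simp: OK_iff intro!: Ints_diff Ints_add)
  then show ?thesis using K_diff[OF zK wK] unfolding OK_iff tr nm by simp
qed

lemma OK_of_int [simp]: "of_int n \<in> OK"
  by (simp add: OK_def)

lemma OK_0 [simp]: "0 \<in> OK" and OK_1 [simp]: "1 \<in> OK"
  using OK_of_int[of 0] OK_of_int[of 1] by simp_all

lemma OK_minus: "z \<in> OK \<Longrightarrow> - z \<in> OK" using OK_diff[of 0 z] by simp

lemma OK_add: "z \<in> OK \<Longrightarrow> w \<in> OK \<Longrightarrow> z + w \<in> OK" using OK_diff[of z "- w"] OK_minus by simp

lemma OK_conj: "z \<in> OK \<Longrightarrow> qconj z \<in> OK"
  by (auto simp: OK_iff qconj_in_K qconj_conj add.commute mult.commute)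

lemma OK_norm: assumes "z \<in> OK" obtains n :: int where "z * qconj z = of_int n"
  using assms by (auto simp: OK_iff elim: Ints_cases)

lemma OK_trace: assumes "z \<in> OK" obtains n :: int where "z + qconj z = of_int n"
  using assms by (auto simp: OK_iff elim: Ints_cases)

end

section \<open>Fractional ideals\<close>

text \<open>
  The additive group generated by all products; for fractional ideals this is the ideal product.
\<close>
definition set_product :: "complex set \<Rightarrow> complex set \<Rightarrow> complex set" where
  "set_product I J = group_closure {x * y | x y. x \<in> I \<and> y \<in> J}"

lemma group_closure_least:
  fixes S M :: "'a :: ab_group_add set"
  assumes "x \<in> group_closure S" "S \<subseteq> M" "0 \<in> M" "\<And>x y. x \<in> M \<Longrightarrow> y \<in> M \<Longrightarrow> x - y \<in> M"
  shows "x \<in> M"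
  using assms(1) by (induction rule: group_closure.induct) (use assms in auto)

lemma set_product_least:
  assumes "z \<in> set_product I J" "\<And>x y. x \<in> I \<Longrightarrow> y \<in> J \<Longrightarrow> x * y \<in> M" "0 \<in> M"
    "\<And>x y. x \<in> M \<Longrightarrow> y \<in> M \<Longrightarrow> x - y \<in> M"
  shows "z \<in> M"
  using assms unfolding set_product_def by (elim group_closure_least) auto

lemma set_product_I: "x \<in> I \<Longrightarrow> y \<in> J \<Longrightarrow> x * y \<in> set_product I J"
  unfolding set_product_def by (rule group_closure.base) auto

lemma set_product_0 [simp]: "0 \<in> set_product I J"
  by (simp add: set_product_def)

lemma set_product_diff: "x \<in> set_product I J \<Longrightarrow> y \<in> set_product I J \<Longrightarrow> x - y \<in> set_product I J"
  unfolding set_product_def by (rule group_closure.diff)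

lemma set_product_commute: "set_product I J = set_product J I"
proof -
  have "{x * y | x y. x \<in> I \<and> y \<in> J} = {x * y | x y. x \<in> J \<and> y \<in> I}"
    by (metis (no_types, lifting) mult.commute)
  then show ?thesis by (simp add: set_product_def)
qed

lemma set_product_assoc_subset:
  "set_product (set_product I J) L \<subseteq> set_product I (set_product J L)"
proof
  let ?M = "set_product I (set_product J L)"
  fix z assume "z \<in> set_product (set_product I J) L"
  then show "z \<in> ?M"
  proof (rule set_product_least)
    fix u l assume u: "u \<in> set_product I J" and l: "l \<in> L"
    from u have "u \<in> {u. u * l \<in> ?M}"
    proof (rule set_product_least)
      fix x y assume "x \<in> I" "y \<in> J"
      then have "x * (y * l) \<in> ?M" using l by (intro set_product_I)
      then show "x * y \<in> {u. u * l \<in> ?M}" by (simp add: mult.assoc)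
    qed (auto simp: left_diff_distrib intro: set_product_diff)
    then show "u * l \<in> ?M" by simp
  qed (auto intro: set_product_diff)
qed

lemma set_product_assoc: "set_product (set_product I J) L = set_product I (set_product J L)"
proof
  show "set_product I (set_product J L) \<subseteq> set_product (set_product I J) L"
    using set_product_assoc_subset[of L J I] by (simp only: set_product_commute)
qed (rule set_product_assoc_subset)

context quadratic begin

lemma carrier_ring_of_integers [simp]: "carrier (ring_of_integers K) = OK"
  by (simp add: ring_of_integers_def OK_def)

lemma ring_of_integers_simps [simp]:
  "x \<otimes>\<^bsub>ring_of_integers K\<^esub> y = x * y"
  "x \<oplus>\<^bsub>ring_of_integers K\<^esub> y = x + y"
  "\<one>\<^bsub>ring_of_integers K\<^esub> = 1"
  "\<zero>\<^bsub>ring_of_integers K\<^esub> = 0"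
  by (simp_all add: ring_of_integers_def ring_of_type_algebra_def)

lemma cring_ring_of_integers: "cring (ring_of_integers K)"
proof (rule cringI)
  show "abelian_group (ring_of_integers K)"
  proof (rule abelian_groupI)
    fix x assume "x \<in> carrier (ring_of_integers K)"
    then show "\<exists>y\<in>carrier (ring_of_integers K). y \<oplus>\<^bsub>ring_of_integers K\<^esub> x = \<zero>\<^bsub>ring_of_integers K\<^esub>"
      by (intro bexI[of _ "- x"]) (auto intro: OK_minus)
  qed (auto intro: OK_add)
  show "comm_monoid (ring_of_integers K)"
    by (rule comm_monoidI) (auto intro: OK_mult)
qed (auto simp: algebra_simps)

text \<open>The additive subgroups of the complex numbers that are closed under multiplication by integers of \<open>K\<close>.\<close>
definition submodule :: "complex set \<Rightarrow> bool" where
  "submodule I \<longleftrightarrow> 0 \<in> I \<and> (\<forall>x\<in>I. \<forall>y\<in>I. x - y \<in> I) \<and> (\<forall>a\<in>OK. \<forall>x\<in>I. a * x \<in> I)"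

lemma submodule_0: "submodule I \<Longrightarrow> 0 \<in> I"
  and submodule_diff: "submodule I \<Longrightarrow> x \<in> I \<Longrightarrow> y \<in> I \<Longrightarrow> x - y \<in> I"
  and submodule_mult: "submodule I \<Longrightarrow> a \<in> OK \<Longrightarrow> x \<in> I \<Longrightarrow> a * x \<in> I"
  by (auto simp: submodule_def)

lemma submodule_minus: "submodule I \<Longrightarrow> x \<in> I \<Longrightarrow> - x \<in> I"
  using submodule_diff[OF _ submodule_0, of I x] submodule_diff[of I 0 x] submodule_0[of I] by simp

lemma submodule_add: "submodule I \<Longrightarrow> x \<in> I \<Longrightarrow> y \<in> I \<Longrightarrow> x + y \<in> I"
  using submodule_diff[of I x "- y"] submodule_minus by simp

lemma submodule_OK: "submodule OK"
  by (auto simp: submodule_def intro: OK_diff OK_mult)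

lemma ideal_iff_submodule: "ideal J (ring_of_integers K) \<longleftrightarrow> J \<subseteq> OK \<and> submodule J"
proof
  interpret R: cring "ring_of_integers K" by (rule cring_ring_of_integers)
  assume "ideal J (ring_of_integers K)"
  then interpret J: ideal J "ring_of_integers K" .
  have J_OK: "J \<subseteq> OK" using J.a_subset by simp
  have neg: "\<ominus>\<^bsub>ring_of_integers K\<^esub> y = - y" if "y \<in> OK" for y
    using that by (intro R.minus_equality) (auto intro: OK_minus)
  have "x - y \<in> J" if "x \<in> J" "y \<in> J" for x y
  proof -
    have "y \<in> OK" using that J_OK by blast
    then have "- y \<in> J" using J.a_inv_closed[OF that(2)] neg[of y] by simp
    then show ?thesis using J.a_closed[OF that(1), of "- y"] by simp
  qed
  moreover have "a * x \<in> J" if "a \<in> OK" "x \<in> J" for a x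
    using J.I_l_closed[of x a] that by simp
  moreover have "0 \<in> J" using J.zero_closed by simp
  ultimately show "J \<subseteq> OK \<and> submodule J" using J_OK by (auto simp: submodule_def)
next
  interpret R: cring "ring_of_integers K" by (rule cring_ring_of_integers)
  assume J: "J \<subseteq> OK \<and> submodule J"
  have neg: "\<ominus>\<^bsub>ring_of_integers K\<^esub> y = - y" if "y \<in> OK" for y
    using that by (intro R.minus_equality) (auto intro: OK_minus)
  show "ideal J (ring_of_integers K)"
  proof (rule idealI)
    show "ring (ring_of_integers K)" by (rule R.ring_axioms)
    show "subgroup J (add_monoid (ring_of_integers K))"
    proof (rule R.add.subgroupI)
      show "J \<noteq> {}" using J submodule_0 by blast
      show "\<ominus>\<^bsub>ring_of_integers K\<^esub> a \<in> J" if "a \<in> J" for a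
        using that neg[of a] J submodule_minus by auto
    qed (use J submodule_add in auto)
    show "x \<otimes>\<^bsub>ring_of_integers K\<^esub> a \<in> J" if "a \<in> J" "x \<in> carrier (ring_of_integers K)" for a x
      using that J submodule_mult[of J x a] by simp
    show "a \<otimes>\<^bsub>ring_of_integers K\<^esub> x \<in> J" if "a \<in> J" "x \<in> carrier (ring_of_integers K)" for a x
      using that J submodule_mult[of J x a] by (simp add: mult.commute[of a x])
  qed
qed

lemma submodule_scale:
  assumes "submodule I" shows "submodule ((\<lambda>x. a * x) ` I)"
  unfolding submodule_def
proof (intro conjI ballI)
  show "0 \<in> (*) a ` I" using submodule_0[OF assms] by (auto intro: rev_image_eqI)
  fix x y assume "x \<in> (*) a ` I" "y \<in> (*) a ` I"
  then show "x - y \<in> (*) a ` I"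
    using submodule_diff[OF assms] by (auto simp flip: right_diff_distrib)
next
  fix b x assume "b \<in> OK" "x \<in> (*) a ` I"
  then show "b * x \<in> (*) a ` I" using submodule_mult[OF assms] by (auto simp: mult.left_commute[of b])
qed

lemma scale_nonzero:
  assumes "submodule I" "I \<noteq> {0}" "a \<noteq> 0" shows "(\<lambda>x. a * x) ` I \<noteq> {0}"
proof -
  obtain x where "x \<in> I" "x \<noteq> 0" using assms(1,2) submodule_0 by blast
  then have "a * x \<in> (\<lambda>x. a * x) ` I" "a * x \<noteq> 0" using assms(3) by auto
  then show ?thesis by (metis singletonD)
qed

lemma fractional_ideal_iff:
  "I \<in> fractional_ideals K \<longleftrightarrow>
     submodule I \<and> I \<noteq> {0} \<and> (\<exists>d\<in>OK. d \<noteq> 0 \<and> (\<forall>x\<in>I. d * x \<in> OK))"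
proof
  assume "I \<in> fractional_ideals K"
  then obtain d J where d: "d \<in> OK" "d \<noteq> 0" and J: "J \<subseteq> OK" "submodule J" "J \<noteq> {0}"
    and I: "I = (\<lambda>x. x / d) ` J"
    by (auto simp: fractional_ideals_def ideal_iff_submodule)
  have I_scale: "I = (\<lambda>x. inverse d * x) ` J" by (simp add: I divide_inverse mult.commute)
  have "submodule I" unfolding I_scale using J(2) by (rule submodule_scale)
  moreover have "I \<noteq> {0}" unfolding I_scale using J d by (intro scale_nonzero) auto
  moreover have "\<forall>x\<in>I. d * x \<in> OK" using d J(1) by (auto simp: I)
  ultimately show "submodule I \<and> I \<noteq> {0} \<and> (\<exists>d\<in>OK. d \<noteq> 0 \<and> (\<forall>x\<in>I. d * x \<in> OK))"
    using d by blast
next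
  assume R: "submodule I \<and> I \<noteq> {0} \<and> (\<exists>d\<in>OK. d \<noteq> 0 \<and> (\<forall>x\<in>I. d * x \<in> OK))"
  then obtain d where d: "d \<in> OK" "d \<noteq> 0" "\<forall>x\<in>I. d * x \<in> OK" by blast
  define J where "J = (\<lambda>x. d * x) ` I"
  have I: "I = (\<lambda>x. x / d) ` J" using d by (auto simp: J_def image_image)
  have "submodule J" unfolding J_def using R by (intro submodule_scale) simp
  moreover have "J \<subseteq> OK" using d by (auto simp: J_def)
  moreover have "J \<noteq> {0}" unfolding J_def using R d by (intro scale_nonzero) auto
  ultimately show "I \<in> fractional_ideals K"
    unfolding fractional_ideals_def using d I by (auto simp: ideal_iff_submodule)
qed

lemma submodule_set_product:
  assumes "submodule I" shows "submodule (set_product I J)"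
  unfolding submodule_def
proof (intro conjI ballI)
  fix a z assume a: "a \<in> OK" and z: "z \<in> set_product I J"
  from z have "z \<in> {z. a * z \<in> set_product I J}"
  proof (rule set_product_least)
    fix x y assume "x \<in> I" "y \<in> J"
    then have "(a * x) * y \<in> set_product I J"
      using submodule_mult[OF assms a] by (intro set_product_I)
    then show "x * y \<in> {z. a * z \<in> set_product I J}" by (simp add: mult.assoc)
  qed (auto simp: right_diff_distrib intro: set_product_diff)
  then show "a * z \<in> set_product I J" by simp
qed (auto intro: set_product_diff)

lemma fractional_ideal_nonzero:
  assumes "I \<in> fractional_ideals K" obtains x where "x \<in> I" "x \<noteq> 0"
  using assms submodule_0 by (auto simp: fractional_ideal_iff)

lemma fractional_ideal_mult:
  assumes I: "I \<in> fractional_ideals K" and J: "J \<in> fractional_ideals K"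
  shows "set_product I J \<in> fractional_ideals K"
proof -
  from I obtain d where d: "d \<in> OK" "d \<noteq> 0" "\<forall>x\<in>I. d * x \<in> OK" by (auto simp: fractional_ideal_iff)
  from J obtain e where e: "e \<in> OK" "e \<noteq> 0" "\<forall>x\<in>J. e * x \<in> OK" by (auto simp: fractional_ideal_iff)
  obtain x where x: "x \<in> I" "x \<noteq> 0" using I by (rule fractional_ideal_nonzero)
  obtain y where y: "y \<in> J" "y \<noteq> 0" using J by (rule fractional_ideal_nonzero)
  have "x * y \<in> set_product I J" "x * y \<noteq> 0" using x y by (auto intro: set_product_I)
  then have ne: "set_product I J \<noteq> {0}" by (metis singletonD)
  have "(d * e) * z \<in> OK" if "z \<in> set_product I J" for z
  proof -
    from that have "z \<in> {z. (d * e) * z \<in> OK}"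
    proof (rule set_product_least)
      fix x y assume "x \<in> I" "y \<in> J"
      then have "(d * x) * (e * y) \<in> OK" using OK_mult[of "d * x" "e * y"] d e by auto
      then show "x * y \<in> {z. (d * e) * z \<in> OK}" by (simp add: mult_ac)
    qed (auto simp: right_diff_distrib intro: OK_diff)
    then show ?thesis by simp
  qed
  moreover have de: "d * e \<in> OK" "d * e \<noteq> 0" using d e by (auto intro: OK_mult)
  moreover have "submodule (set_product I J)" using I submodule_set_product by (auto simp: fractional_ideal_iff)
  ultimately show ?thesis unfolding fractional_ideal_iff using ne by (intro conjI bexI[OF _ de(1)]) auto
qed

lemma fractional_ideal_one: "OK \<in> fractional_ideals K"
proof -
  have "OK \<noteq> {0}" using OK_1 by (metis one_neq_zero singletonD)
  then show ?thesis unfolding fractional_ideal_iff using submodule_OK by (auto intro!: bexI[of _ 1])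
qed

lemma set_product_OK:
  assumes "submodule I" shows "set_product OK I = I"
proof
  show "set_product OK I \<subseteq> I"
    using assms by (auto elim!: set_product_least intro: submodule_mult submodule_0 submodule_diff)
  show "I \<subseteq> set_product OK I" using set_product_I[OF OK_1] by fastforce
qed

text \<open>
  With \<open>g\<close> the greatest common divisor of all norms \<open>N x\<close> of elements of \<open>J\<close>, the number
  \<open>z = x * qconj y / g\<close> is integral for all \<open>x\<close> and \<open>y\<close> in \<open>J\<close>: its norm is \<open>(N x / g) (N y / g)\<close>, and its
  trace is \<open>(N (x + y) - N x - N y) / g\<close>. Conversely \<open>g\<close> is an integral combination of norms, which
  all lie in the product of \<open>J\<close> and its conjugate.
\<close>
lemma ideal_times_conjugate:
  assumes J: "J \<subseteq> OK" "submodule J" "J \<noteq> {0}"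
  obtains g :: int where "g \<noteq> 0" "set_product J (qconj ` J) = (\<lambda>x. of_int g * x) ` OK"
proof -
  have J_K: "x \<in> K" if "x \<in> J" for x using that J(1) OK_subset_K by auto
  define S :: "int set" where "S = {n. \<exists>x\<in>J. x * qconj x = of_int n}"
  define g where "g = Gcd S"
  have nS: "\<exists>n\<in>S. x * qconj x = of_int n" if x: "x \<in> J" for x
  proof -
    have "x \<in> OK" using x J by auto
    then obtain n :: int where "x * qconj x = of_int n" by (rule OK_norm)
    then show ?thesis using x by (auto simp: S_def)
  qed
  obtain x0 where x0: "x0 \<in> J" "x0 \<noteq> 0" using J submodule_0 by blast
  obtain n0 where n0: "n0 \<in> S" "x0 * qconj x0 = of_int n0" using nS[OF x0(1)] by blast
  have "n0 \<noteq> 0" using n0(2) norm_eq_0_iff[OF J_K[OF x0(1)]] x0(2) by auto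
  then have g0: "g \<noteq> 0" using n0(1) by (auto simp: g_def)
  have g_dvd: "g dvd n" if "n \<in> S" for n using that by (simp add: g_def)
  have div_norm: "x * qconj x / of_int g \<in> \<int>" if x: "x \<in> J" for x
  proof -
    obtain n where "n \<in> S" "x * qconj x = of_int n" using nS[OF x] by blast
    then show ?thesis using g_dvd[of n] g0 by (auto elim!: dvdE)
  qed
  have div_OK: "x * qconj y / of_int g \<in> OK" if x: "x \<in> J" and y: "y \<in> J" for x y
  proof -
    note xK = J_K[OF x] and yK = J_K[OF y]
    let ?z = "x * qconj y / of_int g"
    have zK: "?z \<in> K" using xK yK by (intro K_divide K_mult qconj_in_K) simp_all
    have cz: "qconj ?z = qconj x * y / of_int g"
      unfolding divide_inverse using xK yK
      by (simp add: qconj_mult qconj_in_K K_mult Rats_subset_K qconj_conj)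
    have "x + y \<in> J" using J x y submodule_add by blast
    then have "(x + y) * qconj (x + y) / of_int g - x * qconj x / of_int g - y * qconj y / of_int g \<in> \<int>"
      using x y div_norm by (intro Ints_diff) auto
    moreover have "(x + y) * qconj (x + y) / of_int g - x * qconj x / of_int g - y * qconj y / of_int g
        = ?z + qconj ?z"
      unfolding cz qconj_add[OF xK yK] using g0 by (simp add: field_simps)
    ultimately have "?z + qconj ?z \<in> \<int>" by simp
    moreover have "?z * qconj ?z = (x * qconj x / of_int g) * (y * qconj y / of_int g)"
      unfolding cz by (simp add: field_simps)
    then have "?z * qconj ?z \<in> \<int>" using div_norm x y by (simp only:) (intro Ints_mult)
    ultimately show ?thesis using zK by (simp add: OK_iff)
  qed
  let ?P = "set_product J (qconj ` J)"
  have sub: "submodule ?P" using J(2) by (rule submodule_set_product)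
  have "?P \<subseteq> (\<lambda>x. of_int g * x) ` OK"
  proof
    fix z assume "z \<in> ?P"
    then have "z \<in> {z. z / of_int g \<in> OK}"
      by (rule set_product_least) (auto simp: diff_divide_distrib intro: OK_diff div_OK)
    then show "z \<in> (\<lambda>x. of_int g * x) ` OK" using g0 by (auto intro!: rev_image_eqI[of "z / of_int g"])
  qed
  moreover have "of_int g \<in> ?P"
  proof -
    define G :: "int set" where "G = {n. of_int n \<in> ?P}"
    have "S \<subseteq> G"
    proof
      fix n assume "n \<in> S"
      then obtain x where "x \<in> J" "x * qconj x = of_int n" by (auto simp: S_def)
      then show "n \<in> G" using set_product_I[of x J "qconj x" "qconj ` J"] by (auto simp: G_def)
    qed
    moreover have "x - y \<in> G" if "x \<in> G" "y \<in> G" for x y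
      using that by (auto simp: G_def intro: set_product_diff)
    moreover have "0 \<in> G" by (simp add: G_def)
    moreover have "g \<in> group_closure S"
      unfolding g_def by (rule Gcd_in_group_closure)
    ultimately have "g \<in> G" by (blast intro: group_closure_least)
    then show ?thesis by (simp add: G_def)
  qed
  then have "of_int g * x \<in> ?P" if "x \<in> OK" for x
    using submodule_mult[OF sub that, of "of_int g"] by (simp add: mult.commute)
  then have "(\<lambda>x. of_int g * x) ` OK \<subseteq> ?P" by blast
  ultimately show ?thesis by (intro that[OF g0] subset_antisym)
qed

end

section \<open>The ideal class group\<close>

context quadratic begin

lemma fractional_ideal_inverse:
  assumes I: "I \<in> fractional_ideals K"
  shows "\<exists>I'\<in>fractional_ideals K. set_product I' I = OK"
proof -
  from I obtain d where d: "d \<in> OK" "d \<noteq> 0" "\<forall>x\<in>I. d * x \<in> OK" and sI: "submodule I"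
    by (auto simp: fractional_ideal_iff)
  define J where "J = (\<lambda>x. d * x) ` I"
  have J_OK: "J \<subseteq> OK" using d by (auto simp: J_def)
  have sJ: "submodule J" unfolding J_def using sI by (rule submodule_scale)
  obtain x0 where x0: "x0 \<in> I" "x0 \<noteq> 0" using I by (rule fractional_ideal_nonzero)
  then have x0J: "d * x0 \<in> J" "d * x0 \<noteq> 0" using d by (auto simp: J_def)
  then have "J \<noteq> {0}" by blast
  then obtain g :: int where g: "g \<noteq> 0" "set_product J (qconj ` J) = (\<lambda>x. of_int g * x) ` OK"
    using ideal_times_conjugate[OF J_OK sJ] by blast
  have J_K: "x \<in> K" if "x \<in> J" for x using that J_OK OK_subset_K by auto
  define I' where "I' = (\<lambda>x. d * qconj x / of_int g) ` J"
  have sI': "submodule I'"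
    unfolding submodule_def
  proof (intro conjI ballI)
    show "0 \<in> I'" using submodule_0[OF sJ] by (auto simp: I'_def intro!: rev_image_eqI[of 0])
  next
    fix u v assume "u \<in> I'" "v \<in> I'"
    then obtain x y where xy: "x \<in> J" "y \<in> J" "u = d * qconj x / of_int g" "v = d * qconj y / of_int g"
      by (auto simp: I'_def)
    have "u - v = d * qconj (x - y) / of_int g"
      using xy qconj_diff[OF J_K J_K, of x y] by (simp add: right_diff_distrib diff_divide_distrib)
    then show "u - v \<in> I'" using xy submodule_diff[OF sJ] by (auto simp: I'_def)
  next
    fix a u assume a: "a \<in> OK" and "u \<in> I'"
    then obtain x where x: "x \<in> J" "u = d * qconj x / of_int g" by (auto simp: I'_def)
    have "qconj (qconj a * x) = a * qconj x"
      using qconj_mult[OF qconj_in_K[OF OK_subset_K[OF a]] J_K[OF x(1)]] qconj_conj[OF OK_subset_K[OF a]] by simp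
    then have "a * u = d * qconj (qconj a * x) / of_int g" using x by simp
    then show "a * u \<in> I'" using submodule_mult[OF sJ OK_conj[OF a] x(1)] by (auto simp: I'_def)
  qed
  have "d * qconj (d * x0) / of_int g \<in> I'" using x0J by (auto simp: I'_def)
  moreover have "d * qconj (d * x0) / of_int g \<noteq> 0"
    using d g x0J qconj_eq_0_iff[OF J_K[OF x0J(1)]] by simp
  ultimately have ne: "I' \<noteq> {0}" by blast
  have "of_int g * u \<in> OK" if "u \<in> I'" for u
    using that d g J_OK OK_mult OK_conj by (auto simp: I'_def)
  then have frac: "I' \<in> fractional_ideals K"
    unfolding fractional_ideal_iff using sI' ne g by (auto intro!: bexI[of _ "of_int g"])
  have "set_product I' I \<subseteq> OK"
  proof
    fix z assume "z \<in> set_product I' I"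
    then show "z \<in> OK"
    proof (rule set_product_least)
      fix u v assume "u \<in> I'" "v \<in> I"
      then obtain x where x: "x \<in> J" "u = d * qconj x / of_int g" by (auto simp: I'_def)
      have "d * v * qconj x \<in> set_product J (qconj ` J)"
        using x \<open>v \<in> I\<close> by (intro set_product_I) (auto simp: J_def)
      then obtain w where "w \<in> OK" "d * v * qconj x = of_int g * w" unfolding g(2) by blast
      moreover have "u * v = (d * v * qconj x) / of_int g" unfolding x(2) by simp
      ultimately show "u * v \<in> OK" using g(1) by simp
    qed (auto intro: OK_diff)
  qed
  moreover have "1 \<in> set_product I' I"
  proof -
    have "of_int g \<in> set_product J (qconj ` J)" unfolding g(2) by (intro rev_image_eqI[of 1]) auto
    then have "of_int g \<in> {z. z / of_int g \<in> set_product I' I}"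
    proof (rule set_product_least)
      fix u v assume "u \<in> J" "v \<in> qconj ` J"
      then obtain x y where xy: "x \<in> I" "u = d * x" "y \<in> J" "v = qconj y" by (auto simp: J_def)
      have "(d * qconj y / of_int g) * x \<in> set_product I' I"
        using xy by (intro set_product_I) (auto simp: I'_def)
      then show "u * v \<in> {z. z / of_int g \<in> set_product I' I}" using xy by (simp add: mult_ac)
    qed (auto simp: diff_divide_distrib intro: set_product_diff)
    then show ?thesis using g(1) by simp
  qed
  then have "OK \<subseteq> set_product I' I"
    using submodule_mult[OF submodule_set_product[OF sI'], of _ 1 I] by auto
  ultimately show ?thesis using frac by blast
qed

text \<open>The group of fractional ideals and its subgroup of principal ideals.\<close>
abbreviation G :: "complex set monoid" where "G \<equiv> fractional_ideal_group K"
abbreviation H :: "complex set set" where "H \<equiv> principal_fractional_ideals K"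

lemma G_simps [simp]:
  "carrier G = fractional_ideals K"
  "I \<otimes>\<^bsub>G\<^esub> J = set_product I J"
  "\<one>\<^bsub>G\<^esub> = OK"
  by (simp_all add: fractional_ideal_group_def set_product_def)

lemma comm_group_G: "comm_group G"
proof (rule comm_groupI)
  fix I assume "I \<in> carrier G"
  then show "\<one>\<^bsub>G\<^esub> \<otimes>\<^bsub>G\<^esub> I = I" using set_product_OK by (simp add: fractional_ideal_iff)
next
  fix I assume "I \<in> carrier G"
  then show "\<exists>I'\<in>carrier G. I' \<otimes>\<^bsub>G\<^esub> I = \<one>\<^bsub>G\<^esub>" using fractional_ideal_inverse by simp
next
  fix I J assume "I \<in> carrier G" "J \<in> carrier G"
  show "I \<otimes>\<^bsub>G\<^esub> J = J \<otimes>\<^bsub>G\<^esub> I" unfolding G_simps by (rule set_product_commute)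
qed (auto simp: fractional_ideal_mult fractional_ideal_one set_product_assoc)

lemma principal_times_principal:
  "set_product ((\<lambda>x. a * x) ` OK) ((\<lambda>x. b * x) ` OK) = (\<lambda>x. (a * b) * x) ` OK" (is "?L = ?R")
proof
  show "?L \<subseteq> ?R"
  proof
    fix z assume "z \<in> ?L"
    then show "z \<in> ?R"
    proof (rule set_product_least)
      fix u v assume "u \<in> (*) a ` OK" "v \<in> (*) b ` OK"
      then obtain x y where "x \<in> OK" "y \<in> OK" "u = a * x" "v = b * y" by blast
      then show "u * v \<in> ?R" by (intro rev_image_eqI[of "x * y"]) (auto intro: OK_mult)
    next
      show "0 \<in> ?R" by (rule rev_image_eqI[of 0]) auto
    next
      fix u v assume "u \<in> ?R" "v \<in> ?R"
      then obtain x y where "x \<in> OK" "y \<in> OK" "u = a * b * x" "v = a * b * y" by blast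
      then show "u - v \<in> ?R"
        by (intro rev_image_eqI[of "x - y"]) (auto intro: OK_diff simp: right_diff_distrib)
    qed
  qed
  show "?R \<subseteq> ?L"
  proof
    fix z assume "z \<in> ?R"
    then obtain x where x: "x \<in> OK" "z = (a * 1) * (b * x)" by auto
    show "z \<in> ?L" unfolding x(2) using x(1) by (intro set_product_I) auto
  qed
qed

lemma principal_fractional:
  assumes "a \<in> K" "a \<noteq> 0" shows "(\<lambda>x. a * x) ` OK \<in> fractional_ideals K"
proof -
  \<comment> \<open>A common denominator of the two coordinates of \<open>a\<close>.\<close>
  obtain D :: int where D: "D \<noteq> 0" "of_int D * a \<in> OK"
  proof -
    obtain x y where xy: "x \<in> \<rat>" "y \<in> \<rat>" "a = x + y * s" using assms(1) by (rule K_cases)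
    obtain p q where pq: "q \<noteq> 0" "x = of_int p / of_int q" using xy(1) by (metis Rats_cases' less_irrefl)
    obtain p' q' where pq': "q' \<noteq> 0" "y = of_int p' / of_int q'" using xy(2) by (metis Rats_cases' less_irrefl)
    have "s \<in> OK"
    proof -
      have c: "qconj s = - s" using qconj_eq[of 0 1] by simp
      show ?thesis unfolding OK_iff c using s_sq by (auto intro: Ints_minus)
    qed
    then have "of_int (p * q') + of_int (p' * q) * s \<in> OK" by (intro OK_add OK_mult OK_of_int)
    moreover have "of_int (q * q') * a = of_int (p * q') + of_int (p' * q) * s"
      using pq(1) pq'(1) unfolding xy(3) pq(2) pq'(2) by (simp add: field_simps)
    ultimately show ?thesis using pq(1) pq'(1) by (intro that[of "q * q'"]) (simp_all only: mult_eq_0_iff, simp)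
  qed
  have "submodule ((\<lambda>x. a * x) ` OK)" using submodule_OK by (rule submodule_scale)
  moreover have "a \<in> (\<lambda>x. a * x) ` OK" by (rule rev_image_eqI[of 1]) auto
  then have "(\<lambda>x. a * x) ` OK \<noteq> {0}" using assms(2) by (metis singletonD)
  moreover have "of_int D * u \<in> OK" if u: "u \<in> (\<lambda>x. a * x) ` OK" for u
  proof -
    obtain x where "x \<in> OK" "u = a * x" using u by blast
    then show ?thesis using OK_mult[OF D(2), of x] by (simp add: mult.assoc)
  qed
  ultimately show ?thesis unfolding fractional_ideal_iff using D(1)
    by (intro conjI bexI[of _ "of_int D"]) auto
qed

lemma H_iff: "I \<in> H \<longleftrightarrow> (\<exists>a\<in>K. a \<noteq> 0 \<and> I = (\<lambda>x. a * x) ` OK)"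
  by (auto simp: principal_fractional_ideals_def)

lemma subgroup_H: "subgroup H G"
proof -
  interpret G: comm_group G by (rule comm_group_G)
  have one: "OK = (\<lambda>x. 1 * x) ` OK" by simp
  show ?thesis
  proof (rule G.subgroupI)
    show "H \<subseteq> carrier G" using principal_fractional by (auto simp: H_iff)
    show "H \<noteq> {}" using one K_1 zero_neq_one by (metis H_iff empty_iff)
    show "inv\<^bsub>G\<^esub> I \<in> H" if I: "I \<in> H" for I
    proof -
      obtain a where a: "a \<in> K" "a \<noteq> 0" "I = (\<lambda>x. a * x) ` OK" using I by (auto simp: H_iff)
      define I' where "I' = (\<lambda>x. inverse a * x) ` OK"
      have I': "I' \<in> H" unfolding H_iff I'_def using a K_inverse by (intro bexI[of _ "inverse a"]) auto
      have "I' \<otimes>\<^bsub>G\<^esub> I = \<one>\<^bsub>G\<^esub>"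
        unfolding I'_def a(3) G_simps principal_times_principal using a(2) by simp
      then have "inv\<^bsub>G\<^esub> I = I'"
        using I' I principal_fractional by (intro G.inv_equality) (auto simp: H_iff)
      then show ?thesis using I' by simp
    qed
    show "I \<otimes>\<^bsub>G\<^esub> J \<in> H" if I: "I \<in> H" and J: "J \<in> H" for I J
    proof -
      obtain a where a: "a \<in> K" "a \<noteq> 0" "I = (\<lambda>x. a * x) ` OK" using I by (auto simp: H_iff)
      obtain b where b: "b \<in> K" "b \<noteq> 0" "J = (\<lambda>x. b * x) ` OK" using J by (auto simp: H_iff)
      have "a * b \<in> K" "a * b \<noteq> 0" using a b K_mult by auto
      then show ?thesis unfolding G_simps a(3) b(3) principal_times_principal H_iff by blast
    qed
  qed
qed

lemma normal_H: "normal H G"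
  using comm_group.subgroup_imp_normal[OF comm_group_G subgroup_H] .

text \<open>
  The ideal \<open>I = (al, m)\<close> has cube \<open>(al)\<close>. Each product of three generators is divisible by \<open>al\<close>, as
  \<open>m\<^sup>3 = al * qconj al\<close>. Conversely, \<open>T\<^sup>2\<close> and \<open>m\<^sup>3\<close> are coprime, and \<open>al T\<^sup>2\<close> and \<open>al m\<^sup>3\<close> are
  combinations of \<open>al\<^sup>3\<close> and \<open>m\<^sup>3\<close>, which belong to the cube.
\<close>
lemma class_of_order_3:
  assumes al: "al \<in> K" "al + qconj al = of_int T" "al * qconj al = of_int (m ^ 3)"
    and co: "Rings.coprime T m" and m0: "m \<noteq> 0"
    and not_cube: "\<And>u v b. u \<in> OK \<Longrightarrow> v \<in> OK \<Longrightarrow> u * v = 1 \<Longrightarrow> b \<in> OK \<Longrightarrow> al \<noteq> u * b ^ 3"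
  shows "\<exists>c\<in>principal_genus K. group.ord (ideal_class_group K) c = 3"
proof -
  have al_OK: "al \<in> OK" using al by (simp add: OK_iff)
  have al0: "al \<noteq> 0" using al(3) m0 by auto
  have cOK: "qconj al \<in> OK" using al_OK by (rule OK_conj)
  define I where "I = {al * x + of_int m * y | x y. x \<in> OK \<and> y \<in> OK}"
  have I_OK: "I \<subseteq> OK" using al_OK by (auto simp: I_def intro!: OK_add OK_mult)
  have sI: "submodule I"
    unfolding submodule_def
  proof (intro conjI ballI)
    have "0 = al * 0 + of_int m * 0" by simp
    then show "0 \<in> I" using OK_0 unfolding I_def by blast
  next
    fix u v assume "u \<in> I" "v \<in> I"
    then obtain x y x' y' where xy: "x \<in> OK" "y \<in> OK" "x' \<in> OK" "y' \<in> OK"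
      "u = al * x + of_int m * y" "v = al * x' + of_int m * y'" unfolding I_def by blast
    then have "u - v = al * (x - x') + of_int m * (y - y')" by (simp add: algebra_simps)
    then show "u - v \<in> I" using xy OK_diff unfolding I_def by blast
  next
    fix a u assume "a \<in> OK" "u \<in> I"
    then obtain x y where xy: "x \<in> OK" "y \<in> OK" "u = al * x + of_int m * y" unfolding I_def by blast
    then have "a * u = al * (a * x) + of_int m * (a * y)" by (simp add: algebra_simps)
    then show "a * u \<in> I" using xy OK_mult \<open>a \<in> OK\<close> unfolding I_def by blast
  qed
  have al_I: "al \<in> I"
  proof -
    have "al = al * 1 + of_int m * 0" by simp
    then show ?thesis using OK_0 OK_1 unfolding I_def by blast
  qed
  have m_I: "of_int m \<in> I"
  proof -
    have "of_int m = al * 0 + of_int m * 1" by simp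
    then show ?thesis using OK_0 OK_1 unfolding I_def by blast
  qed
  have I_frac: "I \<in> fractional_ideals K"
    unfolding fractional_ideal_iff using sI al_I al0 I_OK by (auto intro!: bexI[of _ 1])
  let ?III = "set_product (set_product I I) I"
  have cube: "?III = (\<lambda>x. al * x) ` OK"
  proof
    have al_div: "\<exists>w\<in>OK. a * b * c = al * w" if abc: "a \<in> I" "b \<in> I" "c \<in> I" for a b c
    proof -
      from abc obtain x1 y1 x2 y2 x3 y3 where
        OKs: "x1 \<in> OK" "y1 \<in> OK" "x2 \<in> OK" "y2 \<in> OK" "x3 \<in> OK" "y3 \<in> OK" and
        eqs: "a = al * x1 + of_int m * y1" "b = al * x2 + of_int m * y2" "c = al * x3 + of_int m * y3"
        unfolding I_def by blast
      have m3: "of_int m * of_int m * of_int m = al * qconj al" using al(3) by (simp add: power3_eq_cube)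
      define w where "w = x1 * b * c + of_int m * y1 * x2 * c + of_int m * y1 * (of_int m * y2 * x3)
        + qconj al * (y1 * y2 * y3)"
      have "a * b * c = al * (x1 * b * c + of_int m * y1 * x2 * c + of_int m * y1 * (of_int m * y2 * x3))
          + of_int m * of_int m * of_int m * (y1 * y2 * y3)"
        unfolding eqs by (simp add: algebra_simps)
      then have "a * b * c = al * w" unfolding m3 w_def by (simp add: algebra_simps)
      moreover have "w \<in> OK" unfolding w_def using OKs abc I_OK cOK
        by (intro OK_add OK_mult OK_of_int) auto
      ultimately show ?thesis by blast
    qed
    have closed: "u - v \<in> (\<lambda>x. al * x) ` OK"
      if "u \<in> (\<lambda>x. al * x) ` OK" "v \<in> (\<lambda>x. al * x) ` OK" for u v
      using that by (auto simp flip: right_diff_distrib intro: OK_diff)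
    have zero: "0 \<in> (\<lambda>x. al * x) ` OK" by (rule rev_image_eqI[of 0]) auto
    show "?III \<subseteq> (\<lambda>x. al * x) ` OK"
    proof
      fix z assume "z \<in> ?III"
      then show "z \<in> (\<lambda>x. al * x) ` OK"
      proof (rule set_product_least)
        fix u c assume u: "u \<in> set_product I I" and c: "c \<in> I"
        from u have "u \<in> {u. u * c \<in> (\<lambda>x. al * x) ` OK}"
        proof (rule set_product_least)
          fix a b assume "a \<in> I" "b \<in> I"
          then show "a * b \<in> {u. u * c \<in> (\<lambda>x. al * x) ` OK}" using al_div[of a b c] c by auto
        qed (use zero closed in \<open>auto simp: left_diff_distrib\<close>)
        then show "u * c \<in> (\<lambda>x. al * x) ` OK" by simp
      qed (use zero closed in auto)
    qed
    have sIII: "submodule ?III" using sI by (intro submodule_set_product)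
    have a3: "al * al * al \<in> ?III" using al_I by (intro set_product_I)
    have m3: "al * qconj al \<in> ?III"
    proof -
      have "of_int m * of_int m * of_int m \<in> ?III" using m_I by (intro set_product_I)
      then show ?thesis using al(3) by (simp add: power3_eq_cube)
    qed
    have "Rings.coprime (T ^ 2) (m ^ 3)" using co by simp
    then obtain p q :: int where "p * T ^ 2 + q * m ^ 3 = 1"
      by (metis bezout_int coprime_imp_gcd_eq_1)
    then have "of_int p * of_int T ^ 2 + of_int q * (of_int (m ^ 3) :: complex) = 1"
      by (metis of_int_1 of_int_add of_int_mult of_int_power)
    then have bez: "of_int p * (al + qconj al) ^ 2 + of_int q * (al * qconj al) = 1"
      using al by simp
    have "al = al * (of_int p * (al + qconj al) ^ 2 + of_int q * (al * qconj al))" unfolding bez by simp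
    also have "\<dots> = of_int p * (al * al * al) +
        (of_int p * (2 * al + qconj al) + of_int q * al) * (al * qconj al)"
      by (simp add: power2_eq_square algebra_simps)
    also have "\<dots> \<in> ?III"
    proof (rule submodule_add[OF sIII submodule_mult[OF sIII OK_of_int a3] submodule_mult[OF sIII _ m3]])
      have "2 * al \<in> OK" using OK_mult[OF OK_of_int[of 2] al_OK] by simp
      then have "2 * al + qconj al \<in> OK" using cOK by (rule OK_add)
      then show "of_int p * (2 * al + qconj al) + of_int q * al \<in> OK"
        using al_OK by (rule OK_add[OF OK_mult[OF OK_of_int] OK_mult[OF OK_of_int]])
    qed
    finally have "al \<in> ?III" .
    then have "al * x \<in> ?III" if "x \<in> OK" for x
      using submodule_mult[OF sIII that] by (simp add: mult.commute)
    then show "(\<lambda>x. al * x) ` OK \<subseteq> ?III" by blast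
  qed
  interpret G: comm_group G by (rule comm_group_G)
  interpret N: normal H G by (rule normal_H)
  interpret C: group "G Mod H" by (rule N.factorgroup_is_group)
  define c where "c = H #>\<^bsub>G\<^esub> I"
  have cC: "c \<in> carrier (G Mod H)" using I_frac by (auto simp: c_def carrier_FactGroup)
  have I3: "I [^]\<^bsub>G\<^esub> (3::nat) = (\<lambda>x. al * x) ` OK"
    using I_frac cube by (simp add: numeral_3_eq_3 set_product_OK[OF sI])
  have "(\<lambda>x. al * x) ` OK \<in> H" using al(1) al0 by (auto simp: H_iff)
  then have "c [^]\<^bsub>G Mod H\<^esub> (3::nat) = H"
    using N.FactGroup_pow[of I 3] I_frac I3 G.coset_join2[OF _ subgroup_H] principal_fractional[OF al(1) al0]
    by (simp add: c_def)
  then have c3: "c [^]\<^bsub>G Mod H\<^esub> (3::nat) = \<one>\<^bsub>G Mod H\<^esub>" by simp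
  have "c \<noteq> \<one>\<^bsub>G Mod H\<^esub>"
  proof
    assume "c = \<one>\<^bsub>G Mod H\<^esub>"
    then have "H #>\<^bsub>G\<^esub> I = H" by (simp add: c_def)
    then have "I \<in> H" using G.coset_join1 subgroup_H I_frac by (metis G_simps(1))
    then obtain b where b: "b \<in> K" "b \<noteq> 0" "I = (\<lambda>x. b * x) ` OK" by (auto simp: H_iff)
    have "b \<in> I" unfolding b(3) by (rule rev_image_eqI[of 1]) auto
    then have bOK: "b \<in> OK" using I_OK by blast
    have eq: "(\<lambda>x. (b * b * b) * x) ` OK = (\<lambda>x. al * x) ` OK"
      using cube unfolding b(3) principal_times_principal .
    have "al \<in> (\<lambda>x. al * x) ` OK" by (rule rev_image_eqI[of 1]) auto
    then obtain u where u: "u \<in> OK" "al = (b * b * b) * u" unfolding eq[symmetric] by blast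
    have "b * b * b \<in> (\<lambda>x. (b * b * b) * x) ` OK" by (rule rev_image_eqI[of 1]) auto
    then obtain v where v: "v \<in> OK" "b * b * b = al * v" unfolding eq by blast
    have "al * (u * v) = al * 1" using u v by (metis mult.assoc mult.commute mult_1_right)
    then have "u * v = 1" using al0 by simp
    moreover have "al = u * b ^ 3" using u(2) by (simp add: power3_eq_cube mult_ac)
    ultimately show False using not_cube u v bOK by blast
  qed
  then have ord: "C.ord c = 3"
  proof -
    have "C.ord c dvd 3" using C.pow_eq_id[OF cC] c3 by blast
    moreover have "prime (3::nat)" by simp
    ultimately have "C.ord c = 1 \<or> C.ord c = 3" by (metis prime_nat_iff)
    then show ?thesis using C.ord_eq_1[OF cC] \<open>c \<noteq> \<one>\<^bsub>G Mod H\<^esub>\<close> by blast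
  qed
  \<comment> \<open>As \<open>c\<close> has order 3, it is the square of its own square.\<close>
  have "c = c [^]\<^bsub>G Mod H\<^esub> (4::nat)"
  proof -
    have "c [^]\<^bsub>G Mod H\<^esub> (Suc 3) = c" using cC c3 by (simp only: C.nat_pow_Suc C.l_one)
    then show ?thesis by (simp add: eval_nat_numeral)
  qed
  also have "\<dots> = (c [^]\<^bsub>G Mod H\<^esub> (2::nat)) \<otimes>\<^bsub>G Mod H\<^esub> (c [^]\<^bsub>G Mod H\<^esub> (2::nat))"
    using cC by (simp only: C.nat_pow_mult) simp
  finally have "c \<in> principal_genus K"
    unfolding principal_genus_def ideal_class_group_def using C.nat_pow_closed[OF cC, of 2] by blast
  then show ?thesis using ord unfolding ideal_class_group_def by blast
qed

end

section \<open>Infinitely many distinct quadratic fields\<close>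

context quadratic begin

lemma quadratic_field_K: "quadratic_field K"
proof -
  interpret R: field "ring_of_type_algebra :: complex ring" by (rule field_from_type_algebra)
  have ops: "x \<oplus>\<^bsub>ring_of_type_algebra\<^esub> y = x + y" "x \<otimes>\<^bsub>ring_of_type_algebra\<^esub> y = x * y"
    "\<one>\<^bsub>ring_of_type_algebra\<^esub> = 1" "\<zero>\<^bsub>ring_of_type_algebra\<^esub> = 0"
    "carrier ring_of_type_algebra = UNIV" for x y :: complex
    by (simp_all add: ring_of_type_algebra_def)
  have neg: "\<ominus>\<^bsub>ring_of_type_algebra\<^esub> x = - x" for x :: complex
    by (rule R.minus_equality) (simp_all add: ops)
  have inv: "inv\<^bsub>ring_of_type_algebra\<^esub> x = inverse x" if "x \<noteq> 0" for x :: complex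
    using that by (intro R.comm_inv_char) (simp_all add: ops)
  have "subring K ring_of_type_algebra"
    by (rule R.subringI) (auto simp: ops neg K_minus K_add K_mult)
  then have "subfield K ring_of_type_algebra"
    by (rule R.subfieldI') (auto simp: ops inv K_inverse)
  moreover have "R.dimension 2 \<rat> K"
  proof -
    have ext: "R.line_extension \<rat> v E = {k * v + w | k w. k \<in> \<rat> \<and> w \<in> E}" for v E
      unfolding set_eq_iff R.line_extension_mem_iff ops mem_Collect_eq by blast
    have "R.dimension (Suc 0) \<rat> (R.line_extension \<rat> 1 {\<zero>\<^bsub>ring_of_type_algebra\<^esub>})"
    proof (rule R.Suc_dim)
      show "R.dimension 0 \<rat> {\<zero>\<^bsub>ring_of_type_algebra\<^esub>}" by (rule R.zero_dim)
    qed (auto simp: ops)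
    moreover have "R.line_extension \<rat> 1 {\<zero>\<^bsub>ring_of_type_algebra\<^esub>} = \<rat>"
      by (auto simp: ext ops)
    ultimately have "R.dimension (Suc 0) \<rat> \<rat>" by simp
    then have "R.dimension (Suc (Suc 0)) \<rat> (R.line_extension \<rat> s \<rat>)"
      using s_irrational by (intro R.Suc_dim) (auto simp: ops)
    moreover have "R.line_extension \<rat> s \<rat> = K"
      unfolding ext adjoin_def by (metis (no_types, opaque_lifting) add.commute)
    ultimately show ?thesis by (simp add: numeral_2_eq_2)
  qed
  ultimately show ?thesis by (simp add: quadratic_field_def)
qed

end

lemma adjoin_eq_imp_square:
  assumes "quadratic d s" "quadratic e t" "adjoin s = adjoin t"
  obtains k where "d * e = k * k"
proof -
  interpret S: quadratic d s by fact
  interpret T: quadratic e t by fact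
  have "s \<in> adjoin t" using S.s_in_K assms(3) by simp
  then obtain x y where xy: "x \<in> \<rat>" "y \<in> \<rat>" "s = x + y * t" by (rule T.K_cases)
  have "of_int d = (x + y * t) * (x + y * t)" using S.s_sq xy(3) by simp
  also have "\<dots> = (x * x + y * y * (t * t)) + (2 * x * y) * t" by (simp add: algebra_simps)
  finally have "of_int d + 0 * t = (x * x + y * y * of_int e) + (2 * x * y) * t" using T.s_sq by simp
  then have eqs: "of_int d = x * x + y * y * of_int e" "0 = 2 * x * y"
    using T.coordinates_unique[of "of_int d" 0 "x * x + y * y * of_int e" "2 * x * y"] xy
    by (simp_all only: Rats_of_int Rats_0 Rats_add Rats_mult Rats_number_of)
  have "y \<noteq> 0" using xy S.s_irrational by auto
  then have "x = 0" using eqs(2) by simp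
  then have "(y * of_int e) * (y * of_int e) = of_int (d * e)" using eqs(1) by simp
  moreover have "y * of_int e \<in> \<rat>" using xy by simp
  ultimately obtain k where "k * k = d * e" using rational_root_of_int by metis
  then show ?thesis using that[of k] by simp
qed

lemma coprime_product_square:
  fixes a b k :: int
  assumes "a * b = k * k" "Rings.coprime a b"
  obtains c where "\<bar>a\<bar> = c * c"
proof (cases "b = 0")
  case True
  then have "\<bar>a\<bar> = 1" using assms(2) by simp
  then show ?thesis using that[of 1] by simp
next
  case b: False
  show ?thesis
  proof (cases "a = 0")
    case True
    then show ?thesis using that[of 0] by simp
  next
    case False
    have "nat \<bar>a\<bar> * nat \<bar>b\<bar> = (nat \<bar>k\<bar>) ^ 2"
      using assms(1) by (metis abs_mult nat_mult_distrib abs_ge_zero power2_eq_square)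
    then have "is_nth_power 2 (nat \<bar>a\<bar> * nat \<bar>b\<bar>)" by (auto simp: is_nth_power_def)
    moreover have "Rings.coprime (nat \<bar>a\<bar>) (nat \<bar>b\<bar>)"
      using assms(2) by (simp flip: coprime_int_iff)
    ultimately have "is_nth_power 2 (nat \<bar>a\<bar>)"
      using False b by - (rule is_nth_power_mult_coprime_natD(1)[of _ "nat \<bar>b\<bar>"], simp_all)
    then obtain c where "nat \<bar>a\<bar> = c ^ 2" by (rule is_nth_powerE)
    then have "int (nat \<bar>a\<bar>) = int (c ^ 2)" by (simp only:)
    then have "\<bar>a\<bar> = int c * int c" by (simp add: power2_eq_square)
    then show ?thesis by (rule that)
  qed
qed

text \<open>
  A family of fields is infinite as soon as each finite part of it can be avoided by a further
  radicand coprime to all radicands in that part.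
\<close>
lemma infinite_quadratic_fields:
  fixes d :: "int \<Rightarrow> int"
  assumes nonsq: "\<And>m c. m \<in> M \<Longrightarrow> \<bar>d m\<bar> \<noteq> c * c"
    and quad: "\<And>m. m \<in> M \<Longrightarrow> quadratic (d m) (s m)"
    and ex: "\<And>A. finite A \<Longrightarrow> A \<subseteq> M \<Longrightarrow> \<exists>m\<in>M. Rings.coprime (d m) (\<Prod>a\<in>A. d a)"
  shows "infinite ((\<lambda>m. adjoin (s m)) ` M)"
proof
  assume "finite ((\<lambda>m. adjoin (s m)) ` M)"
  then obtain A where A: "A \<subseteq> M" "finite A" "(\<lambda>m. adjoin (s m)) ` M = (\<lambda>m. adjoin (s m)) ` A"
    using finite_subset_image[OF _ subset_refl] by metis
  obtain m where m: "m \<in> M" "Rings.coprime (d m) (\<Prod>a\<in>A. d a)" using ex[OF A(2,1)] by blast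
  then obtain a where a: "a \<in> A" "adjoin (s m) = adjoin (s a)" using A(3) by blast
  then obtain k where k: "d m * d a = k * k"
    using adjoin_eq_imp_square quad A(1) m(1) by (metis subsetD)
  have "d a dvd (\<Prod>a\<in>A. d a)" by (rule dvd_prodI[OF A(2) a(1)])
  then have "Rings.coprime (d m) (d a)" using m(2) by (metis coprime_divisors dvd_refl)
  with k obtain c where "\<bar>d m\<bar> = c * c" by (rule coprime_product_square)
  then show False using nonsq m(1) by blast
qed

lemma adjoin_subset_Reals:
  assumes "s \<in> \<real>" shows "adjoin s \<subseteq> \<real>"
proof -
  have "x \<in> \<real>" if "x \<in> \<rat>" for x :: complex
    using that by (rule Rats_cases') simp
  then show ?thesis using assms by (auto simp: adjoin_def intro: Reals_add Reals_mult)
qed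

lemma quadratic_csqrt:
  assumes "\<And>c. d \<noteq> c * c"
  shows "quadratic d (csqrt (of_int d))"
proof
  show sq: "csqrt (of_int d) * csqrt (of_int d) = of_int d"
    by (metis power2_csqrt power2_eq_square)
  show "csqrt (of_int d) \<notin> \<rat>"
    using rational_root_of_int[OF _ sq] assms by metis
qed

section \<open>Units and traces of cubes\<close>

context quadratic begin

text \<open>The units of the ring of integers.\<close>
definition U :: "complex set" where "U = {u \<in> OK. \<exists>v\<in>OK. u * v = 1}"

lemma U_OK: "u \<in> U \<Longrightarrow> u \<in> OK" by (simp add: U_def)

lemma U_1: "1 \<in> U" by (auto simp: U_def intro!: bexI[of _ 1])

lemma U_mult: assumes "u \<in> U" "v \<in> U" shows "u * v \<in> U"
proof -
  obtain u' v' where "u' \<in> OK" "v' \<in> OK" "u * u' = 1" "v * v' = 1" using assms by (auto simp: U_def)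
  moreover from this have "(u * v) * (u' * v') = 1" by (metis mult.assoc mult.commute mult_1)
  ultimately show ?thesis using assms OK_mult unfolding U_def by blast
qed

lemma U_inverse: assumes "u \<in> U" shows "inverse u \<in> U"
proof -
  obtain v where "v \<in> OK" "u * v = 1" using assms by (auto simp: U_def)
  moreover from this have "inverse u = v" using inverse_unique by blast
  ultimately show ?thesis using U_OK[OF assms] by (auto simp: U_def mult.commute)
qed

lemma U_minus: assumes "u \<in> U" shows "- u \<in> U"
proof -
  obtain v where "v \<in> OK" "u * v = 1" using assms by (auto simp: U_def)
  then have "- v \<in> OK" "(- u) * (- v) = 1" using OK_minus by simp_all
  then show ?thesis using OK_minus[OF U_OK[OF assms]] unfolding U_def by blast
qed

lemma U_power_int: "u \<in> U \<Longrightarrow> u powi k \<in> U"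
proof -
  assume u: "u \<in> U"
  have p: "v ^ n \<in> U" if "v \<in> U" for v n using that by (induction n) (auto intro: U_1 U_mult)
  show ?thesis using p[OF u] p[OF U_inverse[OF u]] by (auto simp: power_int_def)
qed

lemma unit_norm:
  assumes "u \<in> U" obtains n :: int where "u * qconj u = of_int n" "n = 1 \<or> n = -1"
proof -
  obtain v where v: "v \<in> OK" "u * v = 1" and u: "u \<in> OK" using assms by (auto simp: U_def)
  note uK = OK_subset_K[OF u] and vK = OK_subset_K[OF v(1)]
  obtain n where n: "u * qconj u = of_int n" using u by (rule OK_norm)
  obtain n' where n': "v * qconj v = of_int n'" using v(1) by (rule OK_norm)
  have "qconj u * qconj v = 1" using qconj_mult[OF uK vK] v(2) by simp
  then have "(u * qconj u) * (v * qconj v) = 1" using v(2)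
    by (metis mult.assoc mult.left_commute mult_1)
  then have "of_int (n * n') = (of_int 1 :: complex)" using n n' by simp
  then have "n * n' = 1" by (simp only: of_int_eq_iff)
  then have "n = 1 \<or> n = -1" by (metis dvdI zdvd1_eq abs_eq_iff' abs_1)
  then show ?thesis using that n by blast
qed

end

lemma (in quadratic) cube_trace_norm:
  assumes "b \<in> K" "b + qconj b = t" "b * qconj b = n"
  shows "b ^ 3 + qconj (b ^ 3) = t ^ 3 - 3 * n * t" "b ^ 3 * qconj (b ^ 3) = n ^ 3"
proof -
  have c: "qconj (b ^ 3) = qconj b ^ 3" using assms(1) by (rule qconj_power)
  show "b ^ 3 + qconj (b ^ 3) = t ^ 3 - 3 * n * t"
    unfolding c assms(2,3)[symmetric] by (simp add: power3_eq_cube algebra_simps)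
  show "b ^ 3 * qconj (b ^ 3) = n ^ 3"
    unfolding c assms(3)[symmetric] by (simp add: power_mult_distrib)
qed

lemma (in quadratic) cube_trace_norm_int:
  assumes b: "b \<in> OK" and T: "b ^ 3 + qconj (b ^ 3) = of_int T" and N: "b ^ 3 * qconj (b ^ 3) = of_int N"
  obtains t n :: int where "T = t ^ 3 - 3 * n * t" "N = n ^ 3"
proof -
  obtain t where t: "b + qconj b = of_int t" using b by (rule OK_trace)
  obtain n where n: "b * qconj b = of_int n" using b by (rule OK_norm)
  have "(of_int T :: complex) = of_int (t ^ 3 - 3 * n * t)" "(of_int N :: complex) = of_int (n ^ 3)"
    using cube_trace_norm[OF OK_subset_K[OF b] t n] T N by simp_all
  then show ?thesis using that by (simp only: of_int_eq_iff)
qed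

section \<open>Imaginary quadratic fields\<close>

text \<open>
  A unit \<open>u\<close> of an imaginary field has norm 1 and trace \<open>t\<close> with \<open>\<bar>t\<bar> \<le> 2\<close>. The values 2 and -2 belong to
  1 and -1, the value 0 to a square root of -1, and the values 1 and -1 to primitive roots of unity
  of order 6 and 3, which exist only if \<open>-3d\<close> is a square.
\<close>
lemma (in quadratic) imaginary_unit_is_cube:
  assumes d: "d < 0" and d3: "\<not> 3 dvd d" and u: "u \<in> U"
  obtains w where "w \<in> OK" "u = w ^ 3"
proof -
  note u_OK = U_OK[OF u]
  note uK = OK_subset_K[OF u_OK]
  obtain x y where xy: "x \<in> \<rat>" "y \<in> \<rat>" "u = x + y * s" using uK by (rule K_cases)
  have c: "qconj u = x - y * s" using qconj_eq xy by simp
  obtain n where n: "u * qconj u = of_int n" and n1: "n = 1 \<or> n = -1" using u by (rule unit_norm)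
  obtain t where t: "u + qconj u = of_int t" using u_OK by (rule OK_trace)
  obtain q r where qr: "x = of_rat q" "y = of_rat r" using xy by (auto elim!: Rats_cases)
  have "u * qconj u = x * x - y * y * (s * s)" unfolding c unfolding xy(3) by (simp add: algebra_simps)
  then have "of_rat (of_int n) = (of_rat (q * q - r * r * of_int d) :: complex)"
    using n s_sq qr by (simp add: of_rat_mult of_rat_diff)
  then have nq: "of_int n = q * q - r * r * of_int d" by (simp only: of_rat_eq_iff)
  have "u + qconj u = 2 * x" unfolding c unfolding xy(3) by simp
  then have "of_rat (of_int t) = (of_rat (2 * q) :: complex)"
    using t qr by (simp add: of_rat_mult)
  then have tq: "of_int t = 2 * q" by (simp only: of_rat_eq_iff)
  have neg: "r * r * of_int d \<le> 0" using d by (simp add: mult_nonneg_nonpos)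
  have "0 \<le> q * q" by simp
  then have "(0::rat) \<le> of_int n" unfolding nq using neg by linarith
  then have n1: "n = 1" using n1 by auto
  have rel: "of_int (t * t) - 4 = 4 * (r * r * of_int d)" using tq nq n1 by (simp add: algebra_simps)
  then have "(of_int (t * t) :: rat) \<le> of_int 4" using neg by simp
  then have "t * t \<le> 4" by (simp only: of_int_le_iff)
  then have "\<bar>t\<bar> \<le> 2" using abs_le_square_iff[of t 2] by (simp add: power2_eq_square)
  then consider "t = 0" | "t = 1 \<or> t = -1" | "t = 2 \<or> t = -2" by linarith
  then show ?thesis
  proof cases
    case 1
    then have "qconj u = - u" using t by (simp add: add_eq_0_iff)
    then have "u * u = -1" using n n1 by (metis minus_equation_iff mult_minus_right of_int_1)
    then have "u = (- u) ^ 3" by (simp add: power3_eq_cube)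
    then show ?thesis using that OK_minus[OF u_OK] by blast
  next
    case 2
    then have "t * t = 1" by auto
    then have "4 * (r * r * of_int d) = -3" using rel by simp
    moreover have "(2 * r * of_int d) * (2 * r * of_int d) = 4 * (r * r * of_int d) * of_int d" by simp
    ultimately have "(2 * r * of_int d) * (2 * r * of_int d) = of_int (- 3 * d)" by simp
    then have "of_rat ((2 * r * of_int d) * (2 * r * of_int d)) = (of_rat (of_int (- 3 * d)) :: complex)"
      by (simp only:)
    then have "(2 * y * of_int d) * (2 * y * of_int d) = of_int (- 3 * d)"
      unfolding qr by (simp only: of_rat_mult of_rat_of_int_eq of_rat_numeral_eq)
    moreover have "2 * y * of_int d \<in> \<rat>" using xy by simp
    ultimately obtain k :: int where k: "k * k = - 3 * d" using rational_root_of_int by metis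
    have "3 dvd k * k" unfolding k by simp
    moreover have "prime (3::int)" by simp
    ultimately have "3 dvd k" using prime_dvd_multD by blast
    then have "3 * 3 dvd k * k" by (rule mult_dvd_mono) fact
    then have "3 * 3 dvd 3 * d" unfolding k by simp
    then have "3 dvd d" by (subst (asm) dvd_times_left_cancel_iff) simp_all
    then show ?thesis using d3 by simp
  next
    case 3
    then have "t * t = 4" by auto
    then have "r * r * of_int d = 0" using rel by simp
    then have "y = 0" using d qr by simp
    then have "u = x" "x = of_rat (of_int t / 2)" using xy tq qr by simp_all
    then have "u = 1 \<or> u = -1" using 3 by (auto simp: of_rat_minus)
    then show ?thesis
    proof
      assume "u = 1" then show ?thesis using that[of 1] by simp
    next
      assume "u = -1" then show ?thesis using that[of "-1"] OK_minus[of 1] by simp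
    qed
  qed
qed

lemma cube_inj:
  fixes m n :: int
  assumes "m ^ 3 = n ^ 3"
  shows "m = n"
proof -
  have "(of_int m :: real) ^ 3 = of_int n ^ 3" using assms by (simp flip: of_int_power)
  then have "root 3 (of_int m ^ 3) = root 3 (of_int n ^ 3)" by simp
  then show ?thesis by (simp add: odd_real_root_power_cancel)
qed

lemma cubic_trace_ne_1:
  fixes t m :: int
  assumes "3 dvd m" "m \<ge> 1"
  shows "t ^ 3 - 3 * m * t \<noteq> 1"
proof
  assume "t ^ 3 - 3 * m * t = 1"
  then have e: "t * (t * t - 3 * m) = 1" by (simp add: power3_eq_cube algebra_simps)
  then have "t = 1 \<or> t = -1" by (metis dvdI zdvd1_eq abs_eq_iff' abs_1)
  then show False using e assms by auto
qed

lemma imaginary_family: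
  fixes m :: int
  assumes m: "m \<ge> 1" "3 dvd m"
  defines "d \<equiv> 1 - 4 * m ^ 3"
  shows "\<bar>d\<bar> \<noteq> c * c"
    and "quadratic d (csqrt (of_int d))"
    and "imaginary_quadratic_field (adjoin (csqrt (of_int d)))"
    and "\<exists>c\<in>principal_genus (adjoin (csqrt (of_int d))).
           group.ord (ideal_class_group (adjoin (csqrt (of_int d)))) c = 3"
proof -
  have "m ^ 3 \<ge> 1" using m by simp
  then have dneg: "d < 0" by (simp add: d_def)
  show "\<bar>d\<bar> \<noteq> c * c" for c
  proof
    assume "\<bar>d\<bar> = c * c"
    then have "c * c = 4 * m ^ 3 - 1" using dneg by (simp add: d_def)
    then have "(c * c) mod 4 = (4 * m ^ 3 - 1) mod 4" by simp
    also have "\<dots> = 3" by presburger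
    finally have "(c mod 4) * (c mod 4) mod 4 = 3" by (simp add: mod_mult_eq)
    moreover have "c mod 4 \<in> {0..<4}" by simp
    then have "c mod 4 \<in> {0, 1, 2, 3}" by (simp add: atLeastLessThan_def) presburger
    ultimately show False by auto
  qed
  have "d \<noteq> c * c" for c using dneg by (metis not_square_less_zero)
  then show Q: "quadratic d (csqrt (of_int d))" by (rule quadratic_csqrt)
  define s where "s = csqrt (of_int d)"
  interpret quadratic d s unfolding s_def by (rule Q)
  have "s \<notin> \<real>"
  proof
    assume "s \<in> \<real>"
    then obtain r where "s = of_real r" by (rule Reals_cases)
    then have "of_real (r * r) = (of_real (of_int d) :: complex)" using s_sq by simp
    then have "r * r = of_int d" by (simp only: of_real_eq_iff)
    then have "0 \<le> (of_int d :: real)" by (metis zero_le_square)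
    then show False using dneg by simp
  qed
  then have "imaginary_quadratic_field (adjoin s)"
    using quadratic_field_K s_in_K unfolding imaginary_quadratic_field_def by blast
  then show "imaginary_quadratic_field (adjoin (csqrt (of_int d)))" by (simp add: s_def)
  define al where "al = (1 / 2) + (1 / 2) * s"
  have al: "al \<in> K" unfolding al_def by (rule K_I) simp_all
  have c: "qconj al = 1 / 2 - (1 / 2) * s" unfolding al_def by (rule qconj_eq) simp_all
  have tr: "al + qconj al = of_int 1" unfolding c unfolding al_def by simp
  have "al * qconj al = 1 / 4 - (1 / 4) * (s * s)" unfolding c unfolding al_def by (simp add: algebra_simps)
  then have nm: "al * qconj al = of_int (m ^ 3)" unfolding s_sq d_def by (simp add: field_simps)
  have "3 dvd 4 * m ^ 3" using m(2) by (simp add: power3_eq_cube)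
  then have d3: "\<not> 3 dvd d" unfolding d_def by presburger
  have "\<exists>c\<in>principal_genus K. group.ord (ideal_class_group K) c = 3"
  proof (rule class_of_order_3[OF al tr nm])
    fix u v b assume u: "u \<in> OK" "v \<in> OK" "u * v = 1" and b: "b \<in> OK"
    show "al \<noteq> u * b ^ 3"
    proof
      assume eq: "al = u * b ^ 3"
      obtain w where w: "w \<in> OK" "u = w ^ 3" using imaginary_unit_is_cube[OF dneg d3] u
        by (auto simp: U_def)
      have al_cube: "al = (w * b) ^ 3" using eq w by (simp add: power_mult_distrib)
      obtain t n where tn: "1 = t ^ 3 - 3 * n * t" "m ^ 3 = n ^ 3"
        using cube_trace_norm_int[OF OK_mult[OF w(1) b], folded al_cube, OF tr nm] .
      have "m = n" using tn(2) m(1) by (metis cube_inj)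
      then show False using tn(1) cubic_trace_ne_1 m by metis
    qed
  qed (use m in auto)
  then show "\<exists>c\<in>principal_genus (adjoin (csqrt (of_int d))).
           group.ord (ideal_class_group (adjoin (csqrt (of_int d)))) c = 3"
    by (simp add: s_def)
qed

lemma infinite_imaginary:
  "infinite {K. imaginary_quadratic_field K \<and>
     (\<exists>c \<in> principal_genus K. group.ord (ideal_class_group K) c = 3)}"
proof -
  define M where "M = {m :: int. m \<ge> 1 \<and> 3 dvd m}"
  define d where "d = (\<lambda>m :: int. 1 - 4 * m ^ 3)"
  have "infinite ((\<lambda>m. adjoin (csqrt (of_int (d m)))) ` M)"
  proof (rule infinite_quadratic_fields)
    show "\<bar>d m\<bar> \<noteq> c * c" if "m \<in> M" for m c
      using imaginary_family(1)[of m c] that by (simp add: M_def d_def)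
    show "quadratic (d m) (csqrt (of_int (d m)))" if "m \<in> M" for m
      using imaginary_family(2)[of m] that by (simp add: M_def d_def)
    fix A assume A: "finite A" "A \<subseteq> M"
    define N where "N = (\<Prod>a\<in>A. d a)"
    have "d a \<noteq> 0" if "a \<in> A" for a
      using imaginary_family(1)[of a 0] that A(2) by (auto simp: M_def d_def)
    then have N0: "N \<noteq> 0" using A(1) by (simp add: N_def)
    \<comment> \<open>\<open>3\<bar>N\<bar>\<close> is an admissible parameter whose radicand is 1 modulo \<open>N\<close>.\<close>
    have "Rings.coprime (d (3 * \<bar>N\<bar>)) N"
    proof (rule coprimeI)
      fix c assume c: "c dvd d (3 * \<bar>N\<bar>)" "c dvd N"
      have "c dvd 4 * (3 * \<bar>N\<bar>) ^ 3" using c(2) by (simp add: power3_eq_cube)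
      then have "c dvd d (3 * \<bar>N\<bar>) + 4 * (3 * \<bar>N\<bar>) ^ 3" using c(1) by simp
      then show "c dvd 1" by (simp add: d_def)
    qed
    moreover have "3 * \<bar>N\<bar> \<in> M" using N0 by (auto simp: M_def)
    ultimately show "\<exists>m\<in>M. Rings.coprime (d m) (\<Prod>a\<in>A. d a)" unfolding N_def by blast
  qed
  moreover have "(\<lambda>m. adjoin (csqrt (of_int (d m)))) ` M \<subseteq> {K. imaginary_quadratic_field K \<and>
     (\<exists>c \<in> principal_genus K. group.ord (ideal_class_group K) c = 3)}"
    using imaginary_family(3,4) by (auto simp: M_def d_def)
  ultimately show ?thesis using finite_subset by blast
qed

section \<open>Real quadratic fields\<close>

text \<open>A multiplicative group of positive reals with finitely many elements in every interval from 1 is cyclic.\<close>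
lemma discrete_positive_group_cyclic:
  fixes G :: "real set"
  assumes pos: "\<And>x. x \<in> G \<Longrightarrow> x > 0" and one: "1 \<in> G"
    and mult: "\<And>x y. x \<in> G \<Longrightarrow> y \<in> G \<Longrightarrow> x * y \<in> G"
    and inv: "\<And>x. x \<in> G \<Longrightarrow> inverse x \<in> G"
    and fin: "\<And>B. finite {x \<in> G. 1 < x \<and> x \<le> B}"
  obtains g where "g \<in> G" "\<And>x. x \<in> G \<Longrightarrow> \<exists>k :: int. x = g powi k"
proof (cases "\<exists>x\<in>G. x > 1")
  case False
  have "x = 1" if "x \<in> G" for x
  proof (rule ccontr)
    assume "x \<noteq> 1"
    then have "x < 1" using False that by force
    then have "inverse x > 1" using pos[OF that] by (simp add: one_less_inverse)
    then show False using False inv[OF that] by blast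
  qed
  then have "\<exists>k :: int. x = 1 powi k" if "x \<in> G" for x using that by simp
  then show ?thesis using that[OF one] by blast
next
  case True
  then obtain x0 where x0: "x0 \<in> G" "x0 > 1" by blast
  define F where "F = {x \<in> G. 1 < x \<and> x \<le> x0}"
  have F: "finite F" "F \<noteq> {}" using fin x0 by (auto simp: F_def)
  define g where "g = Min F"
  have "g \<in> F" unfolding g_def using F by (rule Min_in)
  then have g: "g \<in> G" "g > 1" "g \<le> x0" by (auto simp: F_def)
  have least: "g \<le> x" if "x \<in> G" "x > 1" for x
  proof (cases "x \<le> x0")
    case True
    then have "x \<in> F" using that by (simp add: F_def)
    then show ?thesis unfolding g_def using F by simp
  next
    case False
    then show ?thesis using g(3) by simp
  qed
  have npow: "g ^ n \<in> G" for n by (induction n) (auto intro: one mult g)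
  have ipow: "g powi k \<in> G" for k :: int
    using npow inv by (auto simp: power_int_def power_inverse)
  have "\<exists>k :: int. x = g powi k" if x: "x \<in> G" for x
  proof -
    define k where "k = \<lfloor>ln x / ln g\<rfloor>"
    have lg: "ln g > 0" using g by simp
    have "of_int k \<le> ln x / ln g" "ln x / ln g < of_int k + 1" unfolding k_def by linarith+
    then have b: "of_int k * ln g \<le> ln x" "ln x < of_int (k + 1) * ln g"
      using lg by (simp_all add: field_simps)
    have lnp: "ln (g powi k) = of_int k * ln g" "ln (g powi (k + 1)) = of_int (k + 1) * ln g"
      using g by (simp_all flip: powr_real_of_int' add: ln_powr)
    have gp: "g powi k > 0" "g powi (k + 1) > 0" using g by simp_all
    have le: "g powi k \<le> x" "x < g powi (k + 1)"
      using b lnp gp pos[OF x] by (metis ln_le_cancel_iff, metis ln_less_cancel_iff)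
    define y where "y = x * inverse (g powi k)"
    have y: "y \<in> G" unfolding y_def using mult[OF x inv[OF ipow]] .
    have "y < g"
      using le(2) gp g by (simp add: y_def power_int_add field_simps)
    then have "\<not> y > 1" using least[OF y] by auto
    moreover have "y \<ge> 1" using le(1) gp by (simp add: y_def field_simps)
    ultimately have "y = 1" by simp
    then have "x = g powi k" using gp by (simp add: y_def field_simps)
    then show ?thesis by blast
  qed
  then show ?thesis using that g by blast
qed

context quadratic begin

text \<open>
  Such a unit is a root of \<open>z\<^sup>2 - t z + n\<close> where \<open>n\<close> is 1 or -1, and \<open>\<bar>t\<bar> \<le> B + 1\<close> because the conjugate of
  the unit has absolute value at most 1. There are finitely many such polynomials.
\<close>
lemma finite_bounded_units:
  "finite {u \<in> U. 1 < norm u \<and> norm u \<le> B}"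
proof (rule finite_subset)
  define R where "R = (\<lambda>(t, n). {z :: complex. poly [:of_int n, - of_int t, 1:] z = 0})"
  let ?I = "{- \<lceil>B + 1\<rceil>..\<lceil>B + 1\<rceil>} \<times> {1, -1 :: int}"
  have "finite (R (t, n))" for t n
    unfolding R_def prod.case by (rule poly_roots_finite) simp
  then have "finite (R p)" for p by (cases p) simp
  then show "finite (\<Union>p\<in>?I. R p)" by simp
  show "{u \<in> U. 1 < norm u \<and> norm u \<le> B} \<subseteq> (\<Union>p\<in>?I. R p)"
  proof
    fix u assume "u \<in> {u \<in> U. 1 < norm u \<and> norm u \<le> B}"
    then have u: "u \<in> U" "1 < norm u" "norm u \<le> B" by auto
    obtain n where n: "u * qconj u = of_int n" "n = 1 \<or> n = -1" using u(1) by (rule unit_norm)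
    obtain t where t: "u + qconj u = of_int t" using U_OK[OF u(1)] by (rule OK_trace)
    have "norm u * norm (qconj u) = 1" using n by (metis norm_mult norm_minus_cancel norm_one of_int_1 of_int_minus)
    then have "norm (qconj u) \<le> 1" using u(2) by (metis less_eq_real_def linorder_not_less mult_less_cancel_left2 mult_le_cancel_left1 not_one_less_zero order_less_trans norm_ge_zero mult.commute less_1_mult order_less_irrefl)
    then have "norm (of_int t :: complex) \<le> B + 1"
      using norm_triangle_ineq[of u "qconj u"] u(3) unfolding t by linarith
    then have "\<bar>of_int t :: real\<bar> \<le> B + 1" by simp
    then have "t \<in> {- \<lceil>B + 1\<rceil>..\<lceil>B + 1\<rceil>}" by auto linarith+
    moreover have "u * u - of_int t * u + of_int n = 0"
      unfolding t[symmetric] n(1)[symmetric] by (simp add: algebra_simps)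
    then have "u \<in> R (t, n)" by (simp add: R_def algebra_simps)
    ultimately show "u \<in> (\<Union>p\<in>?I. R p)" using n(2) by blast
  qed
qed

lemma real_units_cyclic:
  assumes "s \<in> \<real>"
  obtains h where "h \<in> U" "\<And>u. u \<in> U \<Longrightarrow> \<exists>k :: int. u = h powi k \<or> u = - (h powi k)"
proof -
  have real: "u = of_real (norm u) \<or> u = - of_real (norm u)" if u: "u \<in> U" for u
  proof -
    have "u \<in> \<real>" using OK_subset_K[OF U_OK[OF u]] adjoin_subset_Reals[OF assms] by blast
    then obtain r where "u = of_real r" by (rule Reals_cases)
    then show ?thesis by (cases "r \<ge> 0") auto
  qed
  have unz: "u \<noteq> 0" if "u \<in> U" for u using that by (auto simp: U_def)
  define A where "A = norm ` U"
  have fin: "finite {x \<in> A. 1 < x \<and> x \<le> B}" for B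
  proof -
    have "{x \<in> A. 1 < x \<and> x \<le> B} = norm ` {u \<in> U. 1 < norm u \<and> norm u \<le> B}" by (auto simp: A_def)
    then show ?thesis using finite_bounded_units by simp
  qed
  have pos: "x > 0" if "x \<in> A" for x using that unz by (auto simp: A_def)
  have one: "1 \<in> A" unfolding A_def using U_1 by (metis imageI norm_one)
  have mult: "x * y \<in> A" if "x \<in> A" "y \<in> A" for x y
    using that U_mult by (auto simp: A_def simp flip: norm_mult)
  have inv: "inverse x \<in> A" if "x \<in> A" for x
    using that U_inverse by (auto simp: A_def simp flip: norm_inverse)
  obtain g where g: "g \<in> A" "\<And>x. x \<in> A \<Longrightarrow> \<exists>k :: int. x = g powi k"
    using discrete_positive_group_cyclic[OF pos one mult inv fin] by blast
  obtain u0 where u0: "u0 \<in> U" "g = norm u0" using g(1) by (auto simp: A_def)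
  then have "of_real g = u0 \<or> of_real g = - u0" using real[of u0] by (metis minus_minus)
  then have gU: "of_real g \<in> U" using u0(1) U_minus[of u0] by metis
  show ?thesis
  proof (rule that[OF gU])
    fix u assume u: "u \<in> U"
    then have "norm u \<in> A" by (simp add: A_def)
    then obtain k :: int where "norm u = g powi k" using g(2) by blast
    then show "\<exists>k :: int. u = of_real g powi k \<or> u = - (of_real g powi k)"
      using real[OF u] by (metis of_real_power_int)
  qed
qed

text \<open>
  If \<open>e = \<plusminus>h\<^sup>j\<close> for a generator \<open>h\<close>, then \<open>j\<close> is not divisible by 3 as \<open>e\<close> is not a cube. So the exponent of
  \<open>u\<close> can be made divisible by 3 by adding a multiple of \<open>j\<close>; signs are cubes.
\<close>
lemma real_units_modulo_cubes:
  assumes s: "s \<in> \<real>" and e: "e \<in> U" "\<And>w. w \<in> OK \<Longrightarrow> e \<noteq> w ^ 3" and u: "u \<in> U"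
  obtains a :: nat and w where "a \<le> 2" "w \<in> OK" "u * e ^ a = w ^ 3"
proof -
  obtain h where h: "h \<in> U" "\<And>u. u \<in> U \<Longrightarrow> \<exists>k :: int. u = h powi k \<or> u = - (h powi k)"
    using s by (rule real_units_cyclic) blast
  have h0: "h \<noteq> 0" using h(1) by (auto simp: U_def)
  have pOK: "h powi l \<in> OK" for l using U_power_int[OF h(1)] by (rule U_OK)
  obtain j where j: "e = h powi j \<or> e = - (h powi j)" using h(2)[OF e(1)] by blast
  obtain k where k: "u = h powi k \<or> u = - (h powi k)" using h(2)[OF u] by blast
  have cube: "(h powi l) ^ 3 = h powi (3 * l)" for l
    by (metis mult.commute power_int_mult power_int_numeral)
  have j3: "\<not> 3 dvd j"
  proof
    assume "3 dvd j"
    then obtain l where "j = 3 * l" by (rule dvdE)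
    then have "e = (h powi l) ^ 3 \<or> e = (- (h powi l)) ^ 3" using j cube[of l] by simp
    then show False using e(2) pOK OK_minus by blast
  qed
  have "\<exists>a \<in> {0, 1, 2 :: nat}. 3 dvd k + int a * j" using j3 by simp presburger
  then obtain a :: nat where "a \<in> {0, 1, 2}" "3 dvd k + int a * j" by blast
  then obtain l where a: "a \<le> 2" "k + int a * j = 3 * l" by (auto elim: dvdE)
  have ea: "e ^ a = h powi (int a * j) \<or> e ^ a = - (h powi (int a * j))"
  proof -
    have "(h powi j) ^ a = h powi (int a * j)" by (metis mult.commute power_int_mult power_int_of_nat)
    then show ?thesis using j by (cases "even a") auto
  qed
  have "h powi k * h powi (int a * j) = (h powi l) ^ 3"
    unfolding cube a(2)[symmetric] using h0 by (simp add: power_int_add)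
  then have "u * e ^ a = (h powi l) ^ 3 \<or> u * e ^ a = (- (h powi l)) ^ 3" using k ea by auto
  then show ?thesis using that a(1) pOK OK_minus by blast
qed

end

lemma cube_trace_mod_9:
  fixes t n T N :: int
  assumes "9 dvd T - 2" "3 dvd N" "T = t ^ 3 - 3 * n * t" "N = n ^ 3"
  shows False
proof -
  have "prime (3::int)" by simp
  then have "3 dvd n" using assms(2,4) prime_dvd_power by blast
  then obtain k where "n = 3 * k" by (rule dvdE)
  then have "3 * n * t = 9 * (k * t)" by simp
  then have "9 dvd 3 * n * t" by (rule dvdI)
  then have "9 dvd (T - 2) + 3 * n * t" using assms(1) by (rule dvd_add[rotated])
  then have "9 dvd t ^ 3 - 2" using assms(3) by simp
  then have "t ^ 3 mod 9 = 2" by presburger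
  then have "(t mod 9) ^ 3 mod 9 = 2" by (simp add: power_mod)
  moreover have "t mod 9 \<in> {0..<9}" by simp
  then have "t mod 9 \<in> {0, 1, 2, 3, 4, 5, 6, 7, 8}" by (simp add: atLeastLessThan_def) presburger
  ultimately show False by auto
qed

text \<open>The left-hand side increases with \<open>t\<close> and passes \<open>m\<^sup>3\<close> strictly between \<open>t = m - 1\<close> and \<open>t = m\<close>.\<close>
lemma cubic_between_cubes:
  fixes t m :: int
  assumes "m \<ge> 1"
  shows "t ^ 3 + 3 * t \<noteq> m ^ 3"
proof
  assume eq: "t ^ 3 + 3 * t = m ^ 3"
  show False
  proof (cases "t \<ge> m")
    case True
    then have "m ^ 3 \<le> t ^ 3" by (intro power_mono) (use assms in auto)
    then show False using eq True assms by linarith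
  next
    case False
    define p where "p = m - 1"
    have m_eq: "m ^ 3 = p ^ 3 + 3 * p ^ 2 + 3 * p + 1"
      by (simp add: p_def power2_eq_square power3_eq_cube algebra_simps)
    have "t \<le> p" using False by (simp add: p_def)
    moreover from this have "t ^ 3 \<le> p ^ 3" by (intro power_mono_odd) auto
    moreover have "p ^ 2 \<ge> 0" by simp
    ultimately show False using eq m_eq by linarith
  qed
qed

lemma real_family:
  fixes m :: int
  assumes m: "m \<ge> 1" "3 dvd m" "odd m"
  defines "d \<equiv> m ^ 6 + 4"
  shows "\<bar>d\<bar> \<noteq> c * c"
    and "quadratic d (csqrt (of_int d))"
    and "real_quadratic_field (adjoin (csqrt (of_int d)))"
    and "\<exists>c\<in>principal_genus (adjoin (csqrt (of_int d))).
           group.ord (ideal_class_group (adjoin (csqrt (of_int d)))) c = 3"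
proof -
  have "m \<ge> 3" using m by presburger
  then have m3: "m ^ 3 \<ge> 27" using power_mono[of 3 m 3] by simp
  have m6: "m ^ 6 = m ^ 3 * m ^ 3" by (simp flip: power_add)
  have dpos: "d > 0" unfolding d_def m6 using m3 by (intro add_nonneg_pos) simp_all
  have nonsq: "d \<noteq> c * c" for c
  proof
    assume "d = c * c"
    have eq: "\<bar>c\<bar> * \<bar>c\<bar> = m ^ 3 * m ^ 3 + 4"
      using \<open>d = c * c\<close> unfolding abs_mult_self_eq d_def m6 by (rule sym)
    show False
    proof (cases "\<bar>c\<bar> \<le> m ^ 3")
      case True
      then have "\<bar>c\<bar> * \<bar>c\<bar> \<le> m ^ 3 * m ^ 3" using m3 m(1) by (intro mult_mono) auto
      then show False using eq by simp
    next
      case False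
      then have "(m ^ 3 + 1) * (m ^ 3 + 1) \<le> \<bar>c\<bar> * \<bar>c\<bar>" using m3 by (intro mult_mono) auto
      then have "(m ^ 3 + 1) * (m ^ 3 + 1) \<le> m ^ 3 * m ^ 3 + 4" unfolding eq .
      then show False using m3 by (simp add: algebra_simps)
    qed
  qed
  then show "\<bar>d\<bar> \<noteq> c * c" for c using dpos by simp
  show Q: "quadratic d (csqrt (of_int d))" using nonsq by (rule quadratic_csqrt)
  define s where "s = csqrt (of_int d)"
  interpret quadratic d s unfolding s_def by (rule Q)
  have "s = of_real (sqrt (of_int d))"
    unfolding s_def using dpos csqrt_of_real_nonneg[of "of_int d"] by simp
  then have s_real: "s \<in> \<real>" by simp
  have "K \<subseteq> \<real>" using s_real by (rule adjoin_subset_Reals)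
  then have "real_quadratic_field (adjoin s)"
    using quadratic_field_K by (simp add: real_quadratic_field_def)
  then show "real_quadratic_field (adjoin (csqrt (of_int d)))" by (simp add: s_def)
  \<comment> \<open>The unit \<open>e\<close> has conjugate \<open>e'\<close> and norm -1.\<close>
  define e where "e = of_int (m ^ 3) / 2 + (1 / 2) * s"
  define e' where "e' = of_int (m ^ 3) / 2 - (1 / 2) * s"
  have e: "e \<in> K" unfolding e_def by (rule K_I) simp_all
  have c: "qconj e = e'" unfolding e_def e'_def by (rule qconj_eq) simp_all
  have tr: "e + e' = of_int (m ^ 3)" unfolding e_def e'_def by simp
  have "e * e' = of_int (m ^ 3) * of_int (m ^ 3) / 4 - (1 / 4) * (s * s)"
    unfolding e_def e'_def by (simp add: algebra_simps)
  then have nm: "e * e' = - 1" unfolding s_sq d_def m6 by (simp add: field_simps)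
  have e_OK: "e \<in> OK" unfolding OK_iff c using e tr nm by simp
  have e'_OK: "e' \<in> OK" using OK_conj[OF e_OK] c by simp
  note e'K = OK_subset_K[OF e'_OK]
  have c': "qconj e' = e" using qconj_conj[OF e] c by simp
  have "e * (- e') = 1" using nm by simp
  then have e_U: "e \<in> U" unfolding U_def using e_OK OK_minus[OF e'_OK] by blast
  have e_not_cube: "e \<noteq> w ^ 3" if w: "w \<in> OK" for w
  proof
    assume ew: "e = w ^ 3"
    have "e + qconj e = of_int (m ^ 3)" "e * qconj e = of_int (-1)" using tr nm c by simp_all
    then obtain t n where tn: "m ^ 3 = t ^ 3 - 3 * n * t" "-1 = n ^ 3"
      using cube_trace_norm_int[OF w, folded ew] by blast
    have "n = -1" by (rule cube_inj) (use tn(2)[symmetric] in simp)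
    then show False using tn(1) cubic_between_cubes[OF m(1), of t] by simp
  qed
  define al where "al = e + 1"
  have al: "al \<in> K" unfolding al_def using e by (intro K_add) simp_all
  have cal: "qconj al = e' + 1" unfolding al_def using qconj_add[OF e K_1] c by simp
  have tr_al: "al + qconj al = of_int (m ^ 3 + 2)" using tr unfolding cal unfolding al_def by (simp add: algebra_simps)
  have "al * qconj al = e * e' + (e + e') + 1" unfolding cal unfolding al_def by (simp add: algebra_simps)
  then have nm_al: "al * qconj al = of_int (m ^ 3)" unfolding nm tr by simp
  have no_cube: False
    if zx: "z \<in> OK" "x = z ^ 3" "x + qconj x = of_int T" "x * qconj x = of_int N" "9 dvd T - 2" "3 dvd N" for z x T N
  proof -
    obtain t n where "T = t ^ 3 - 3 * n * t" "N = n ^ 3"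
      using cube_trace_norm_int[OF zx(1), folded zx(2), OF zx(3,4)] .
    then show False using cube_trace_mod_9 zx(5,6) by blast
  qed
  have nine: "9 dvd m ^ 3"
  proof -
    obtain k where "m = 3 * k" using m(2) by (rule dvdE)
    then have "m ^ 3 = 9 * (3 * k ^ 3)" by (simp add: power_mult_distrib)
    then show ?thesis by simp
  qed
  have three: "3 dvd m ^ 3" using m(2) by (simp add: power3_eq_cube)
  have "\<exists>c\<in>principal_genus K. group.ord (ideal_class_group K) c = 3"
  proof (rule class_of_order_3[OF al tr_al nm_al])
    show "Rings.coprime (m ^ 3 + 2) m"
    proof (rule coprimeI)
      fix x assume x: "x dvd m ^ 3 + 2" "x dvd m"
      have "x dvd m ^ 3" using x(2) by (simp add: power3_eq_cube)
      then have "x dvd 2" using x(1) by (simp add: dvd_add_right_iff)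
      moreover have "Rings.coprime 2 m" using m(3) by simp
      ultimately show "x dvd 1" using x(2) by (meson coprime_common_divisor)
    qed
    show "m \<noteq> 0" using m by simp
    fix u v b assume u: "u \<in> OK" "v \<in> OK" "u * v = 1" and b: "b \<in> OK"
    show "al \<noteq> u * b ^ 3"
    proof
      assume eq: "al = u * b ^ 3"
      have "u \<in> U" using u by (auto simp: U_def)
      then obtain a w where a: "a \<le> 2" and w: "w \<in> OK" "u * e ^ a = w ^ 3"
        using real_units_modulo_cubes[OF s_real e_U e_not_cube] by blast
      define z where "z = w * b"
      have z: "z \<in> OK" unfolding z_def using w(1) b by (rule OK_mult)
      have "al * e ^ a = (u * e ^ a) * b ^ 3" unfolding eq by simp
      then have zc: "al * e ^ a = z ^ 3" unfolding w(2) z_def by (simp add: power_mult_distrib)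
      consider "a = 0" | "a = 1" | "a = 2" using a by linarith
      then show False
      proof cases
        case 1
        then have "al = z ^ 3" using zc by simp
        then show False using no_cube[OF z _ tr_al nm_al] nine three by simp
      next
        case 2
        define x where "x = al * e"
        have cx: "qconj x = (e' + 1) * e'" unfolding x_def qconj_mult[OF al e] cal c ..
        have "x + qconj x = (e + e') * (e + e') - 2 * (e * e') + (e + e')"
          unfolding cx unfolding x_def al_def by (simp add: algebra_simps)
        then have trx: "x + qconj x = of_int (m ^ 3 * m ^ 3 + 2 + m ^ 3)" unfolding nm tr by simp
        have "x * qconj x = (al * qconj al) * (e * e')"
          unfolding cx unfolding cal x_def by (simp add: algebra_simps)
        then have nmx: "x * qconj x = of_int (- (m ^ 3))" unfolding nm nm_al by simp
        have xz: "x = z ^ 3" using zc 2 by (simp add: x_def)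
        have "9 dvd (m ^ 3 * m ^ 3 + 2 + m ^ 3) - 2"
          using dvd_mult2[OF nine, of "m ^ 3 + 1"] by (simp add: algebra_simps)
        then show False using no_cube[OF z xz trx nmx] three by simp
      next
        case 3
        \<comment> \<open>Dividing by \<open>e\<^sup>3\<close> replaces \<open>al * e\<^sup>2\<close> by \<open>al / e = 1 - e'\<close>, whose trace is easier to handle.\<close>
        define x where "x = 1 - e'"
        have cx: "qconj x = 1 - e" unfolding x_def using qconj_diff[OF K_1 e'K] c' by simp
        have "x + qconj x = 2 - (e + e')" unfolding cx unfolding x_def by simp
        then have trx: "x + qconj x = of_int (2 - m ^ 3)" unfolding tr by simp
        have "x * qconj x = 1 - (e + e') + e * e'" unfolding cx unfolding x_def by (simp add: algebra_simps)
        then have nmx: "x * qconj x = of_int (- (m ^ 3))" unfolding nm tr by simp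
        have xz: "x = (z * (- e')) ^ 3"
        proof -
          have "(z * (- e')) ^ 3 = (al * e ^ 2) * (- e') ^ 3" using zc 3 by (simp add: power_mult_distrib)
          also have "\<dots> = - (e * e') * (e * e') * (e * e' + e')"
            unfolding al_def by (simp add: power2_eq_square power3_eq_cube algebra_simps)
          also have "\<dots> = x" unfolding nm x_def by simp
          finally show ?thesis ..
        qed
        have zOK: "z * (- e') \<in> OK" using z OK_minus[OF e'_OK] by (rule OK_mult)
        have "9 dvd (2 - m ^ 3) - 2" using nine by simp
        then show False using no_cube[OF zOK xz trx nmx] three by simp
      qed
    qed
  qed
  then show "\<exists>c\<in>principal_genus (adjoin (csqrt (of_int d))).
           group.ord (ideal_class_group (adjoin (csqrt (of_int d)))) c = 3"
    by (simp add: s_def)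
qed

lemma infinite_real:
  "infinite {K. real_quadratic_field K \<and>
     (\<exists>c \<in> principal_genus K. group.ord (ideal_class_group K) c = 3)}"
proof -
  define M where "M = {m :: int. m \<ge> 1 \<and> 3 dvd m \<and> odd m}"
  define d where "d = (\<lambda>m :: int. m ^ 6 + 4)"
  have "infinite ((\<lambda>m. adjoin (csqrt (of_int (d m)))) ` M)"
  proof (rule infinite_quadratic_fields)
    show "\<bar>d m\<bar> \<noteq> c * c" if "m \<in> M" for m c
      using real_family(1)[of m c] that by (simp add: M_def d_def)
    show "quadratic (d m) (csqrt (of_int (d m)))" if "m \<in> M" for m
      using real_family(2)[of m] that by (simp add: M_def d_def)
    fix A assume A: "finite A" "A \<subseteq> M"
    define N where "N = (\<Prod>a\<in>A. d a)"
    have "odd (d a)" if "a \<in> A" for a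
      using that A(2) by (auto simp: M_def d_def)
    then have N: "odd N" using A(1) by (simp add: N_def even_prod_iff)
    then have N0: "N \<noteq> 0" by auto
    \<comment> \<open>\<open>3\<bar>N\<bar>\<close> is an admissible parameter whose radicand is 4 modulo the odd number \<open>N\<close>.\<close>
    have "Rings.coprime (d (3 * \<bar>N\<bar>)) N"
    proof (rule coprimeI)
      fix c assume c: "c dvd d (3 * \<bar>N\<bar>)" "c dvd N"
      have "c dvd (3 * \<bar>N\<bar>)" using c(2) by simp
      then have "c dvd (3 * \<bar>N\<bar>) ^ 6" by (rule dvd_power_le[of c _ 1 6, simplified])
      then have "c dvd d (3 * \<bar>N\<bar>) - (3 * \<bar>N\<bar>) ^ 6" using c(1) by (intro dvd_diff)
      then have "c dvd 2 ^ 2" by (simp add: d_def)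
      moreover have "Rings.coprime (2 ^ 2) N" using N by (simp only: coprime_power_left_iff) simp
      ultimately show "c dvd 1" using c(2) by (meson coprime_common_divisor)
    qed
    moreover have "3 * \<bar>N\<bar> \<in> M" using N0 N by (auto simp: M_def)
    ultimately show "\<exists>m\<in>M. Rings.coprime (d m) (\<Prod>a\<in>A. d a)" unfolding N_def by blast
  qed
  moreover have "(\<lambda>m. adjoin (csqrt (of_int (d m)))) ` M \<subseteq> {K. real_quadratic_field K \<and>
     (\<exists>c \<in> principal_genus K. group.ord (ideal_class_group K) c = 3)}"
    using real_family(3,4) by (auto simp: M_def d_def)
  ultimately show ?thesis using finite_subset by blast
qed

theorem theorem89:
  shows "infinite {K. real_quadratic_field K \<and>
           (\<exists>c \<in> principal_genus K. group.ord (ideal_class_group K) c = 3)} \<and>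
         infinite {K. imaginary_quadratic_field K \<and>
           (\<exists>c \<in> principal_genus K. group.ord (ideal_class_group K) c = 3)}"
  using infinite_real infinite_imaginary by simp

end
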